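(* (a) Fix a nonnegative integer $b$ and a real number $c\in(b,\infty)$. For $\alpha\in(0,\infty)$ let $\rho_{b,\alpha}$ be the measure on $\mathbb N_b$ having components $$\rho_{b,\alpha;j}=\frac{1}{Z_b(\alpha)}\cdot\frac{\alpha^j}{j!}\quad\text{for }j\in\mathbb N_b,$$ where $Z_0(\alpha)=e^\alpha$ and, for $b\in\mathbb N$, $Z_b(\alpha)=e^\alpha-\sum_{j=0}^{b-1}\alpha^j/j!$. Then there exists a unique value $\alpha_b(c)\in(0,\infty)$ such that $\rho_{b,\alpha_b(c)}$ lies in the set $\mathcal P_{\mathbb N_b,c}$ of probability measures on $\mathbb N_b$ having mean $c$. If $b=0$, then $\alpha_0(c)=c$. If $b\in\mathbb N$, then $\alpha_b(c)$ is the unique solution in $(0,\infty)$ of $\alpha Z_{b-1}(\alpha)/Z_b(\alpha)=c$. (b) Fix a nonnegative integer $b$ and a rational number $c\in(b,\infty)$. Let $m=m(N)$ satisfy $m(N)\to\infty$ and $m(N)^2/N\to0$ as $N\to\infty$. For any $\nu\in A_{N,b,m}$ define $\theta_{N,b,\nu}\in\mathcal P_{\mathbb N_b,c}$ to have the components $\theta_{N,b,\nu;j}=\nu_j/N$ for $j\in\mathbb N_b$. Then the relative entropy $R(\theta_{N,b,\nu}|\rho_{b,\alpha_b(c)})$ is finite, and we have the local large deviation estimate $$\frac1N\log P_{N,b,m}(\Theta_{N,b}=\theta_{N,b,\nu})=-R(\theta_{N,b,\nu}|\rho_{b,\alpha_b(c)})+\varepsilon_N(\nu),$$ where $\varepsilon_N(\nu)\to0$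 uniformly for $\nu\in A_{N,b,m}$ as $N\to\infty$.
   Context: Notation: $\mathbb N=\{1,2,\dots\}$, $\mathbb N_b=\{n\in\mathbb Z:n\ge b\}$, so $\mathbb N_0$ is the set of nonnegative integers. For part (b): $N$ ranges only over integers $N\ge2$ for which $K:=cN$ is an integer, and limits $N\to\infty$ are along such $N$. $m=m(N)$ is an integer with $2\le m(N)\le N$. Model: $\Lambda_N=\{1,\dots,N\}$ and $\Omega_N=\Lambda_N^K$ is the set of $\omega=(\omega_1,\dots,\omega_K)$. For $\ell\in\Lambda_N$, $K_\ell(\omega)=\mathrm{card}\{i:\omega_i=\ell\}$; for integers $j\ge0$, $N_j(\omega)=\mathrm{card}\{\ell\in\Lambda_N:K_\ell(\omega)=j\}$; $|N(\omega)|_+=\mathrm{card}\{j\in\mathbb N_b:N_j(\omega)\ge1\}$. Set $\Omega_{N,b,m}=\{\omega\in\Omega_N:K_\ell(\omega)\ge b\ \forall\ell\in\Lambda_N,\ |N(\omega)|_+\le m(N)\}$, and let $P_{N,b,m}$ be the uniform probability measure on $\Omega_{N,b,m}$. The number-density measure $\Theta_{N,b}(\omega)$, $\omega\in\Omega_{N,b,m}$, is the probability measure on $\mathbb N_b$ giving mass $N_j(\omega)/N$ to each $j\in\mathbb N_b$. $A_{N,b,m}$ is the set of sequences $\nu=\{\nu_j,j\in\mathbb N_b\}$ with $\nu_j\in\mathbb N_0$, $\sum_{j\in\mathbb N_b}\nu_j=N$, $\sum_{j\in\mathbb N_b}j\nu_j=K$, and $|\nu|_+:=\mathrm{card}\{j\in\mathbb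 N_b:\nu_j\ge1\}\le m(N)$. Relative entropy: $R(\theta|\rho)=\sum_{j\in\mathbb N_b}\theta_j\log(\theta_j/\rho_j)$ with $0\log0=0$. *)

theory Defs
  imports "HOL-Probability.Probability"
begin

definition Omega :: "nat \<Rightarrow> nat \<Rightarrow> (nat \<Rightarrow> nat) set" where
  "Omega N K = {1..K} \<rightarrow>\<^sub>E {1..N}"

text \<open>\<open>occ K \<omega> l\<close> is $K_\ell(\omega)$; \<open>occ_num N K \<omega> j\<close> is $N_j(\omega)$.\<close>

definition occ :: "nat \<Rightarrow> (nat \<Rightarrow> nat) \<Rightarrow> nat \<Rightarrow> nat" where
  "occ K \<omega> l = card {i \<in> {1..K}. \<omega> i = l}"

definition occ_num :: "nat \<Rightarrow> nat \<Rightarrow> (nat \<Rightarrow> nat) \<Rightarrow> nat \<Rightarrow> nat" where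
  "occ_num N K \<omega> j = card {l \<in> {1..N}. occ K \<omega> l = j}"

text \<open>$|\nu|_+$ for a sequence indexed by $j \ge b$. It is only applied to sequences of finite
  support, so the value of \<open>card\<close> on infinite sets is irrelevant.\<close>

definition num_pos :: "nat \<Rightarrow> (nat \<Rightarrow> nat) \<Rightarrow> nat" where
  "num_pos b \<nu> = card {j \<in> {b..}. 1 \<le> \<nu> j}"

text \<open>In \<open>Omega_bm\<close>, \<open>P_unif\<close> and \<open>A_set\<close> the argument \<open>M\<close> is the value $m(N)$.\<close>

definition Omega_bm :: "nat \<Rightarrow> nat \<Rightarrow> nat \<Rightarrow> nat \<Rightarrow> (nat \<Rightarrow> nat) set" where
  "Omega_bm N K b M =
     {\<omega> \<in> Omega N K. (\<forall>l\<in>{1..N}. b \<le> occ K \<omega> l) \<and> num_pos b (occ_num N K \<omega>) \<le> M}"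

definition P_unif :: "nat \<Rightarrow> nat \<Rightarrow> nat \<Rightarrow> nat \<Rightarrow> (nat \<Rightarrow> nat) measure" where
  "P_unif N K b M = uniform_count_measure (Omega_bm N K b M)"

text \<open>Measures on $\{j : j \ge b\}$, with its discrete $\sigma$-algebra, from their components.\<close>

definition measure_of_comps :: "nat \<Rightarrow> (nat \<Rightarrow> real) \<Rightarrow> nat measure" where
  "measure_of_comps b w = point_measure {b..} (\<lambda>j. ennreal (w j))"

definition prob_mean :: "nat \<Rightarrow> real \<Rightarrow> nat measure set" where
  "prob_mean b c =
     {\<mu>. space \<mu> = {b..} \<and> sets \<mu> = Pow {b..} \<and> prob_space \<mu> \<and>
         integrable \<mu> real \<and> integral\<^sup>L \<mu> real = c}"

definition Theta :: "nat \<Rightarrow> nat \<Rightarrow> nat \<Rightarrow> (nat \<Rightarrow> nat) \<Rightarrow> nat measure" where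
  "Theta N K b \<omega> = measure_of_comps b (\<lambda>j. real (occ_num N K \<omega> j) / real N)"

definition theta :: "nat \<Rightarrow> nat \<Rightarrow> (nat \<Rightarrow> nat) \<Rightarrow> nat measure" where
  "theta N b \<nu> = measure_of_comps b (\<lambda>j. real (\<nu> j) / real N)"

definition A_set :: "nat \<Rightarrow> nat \<Rightarrow> nat \<Rightarrow> nat \<Rightarrow> (nat \<Rightarrow> nat) set" where
  "A_set N K b M =
     {\<nu> \<in> {b..} \<rightarrow>\<^sub>E UNIV. (\<nu> has_sum N) {b..} \<and> ((\<lambda>j. j * \<nu> j) has_sum K) {b..} \<and>
         num_pos b \<nu> \<le> M}"

text \<open>For \<open>b = 0\<close> the subtracted sum is empty, so \<open>Z 0 \<alpha> = exp \<alpha>\<close>.\<close>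

definition Z :: "nat \<Rightarrow> real \<Rightarrow> real" where
  "Z b \<alpha> = exp \<alpha> - (\<Sum>j<b. \<alpha> ^ j / fact j)"

definition rho :: "nat \<Rightarrow> real \<Rightarrow> nat measure" where
  "rho b \<alpha> = measure_of_comps b (\<lambda>j. 1 / Z b \<alpha> * (\<alpha> ^ j / fact j))"

definition alpha :: "nat \<Rightarrow> real \<Rightarrow> real" where
  "alpha b c = (THE \<alpha>. 0 < \<alpha> \<and> rho b \<alpha> \<in> prob_mean b c)"

text \<open>The sum is taken in the extended reals. For probability measures the negative parts of the
  summands are summable (because $x \log (x/y) \ge x - y$), so a divergent sum has the value
  \<open>\<infinity>\<close>, and finiteness of the relative entropy is a genuine condition. The conventions are
  $0 \log 0 = 0$ and $x \log (x/0) = \infty$ for $x > 0$.\<close>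

definition rel_entropy :: "nat \<Rightarrow> nat measure \<Rightarrow> nat measure \<Rightarrow> ereal" where
  "rel_entropy b \<theta> \<rho> =
     (\<Sum>\<^sub>\<infinity>j\<in>{b..}.
        if measure \<theta> {j} = 0 then 0
        else if measure \<rho> {j} = 0 then \<infinity>
        else ereal (measure \<theta> {j} * ln (measure \<theta> {j} / measure \<rho> {j})))"

definition admissible :: "real \<Rightarrow> nat set" where
  "admissible c = {N. 2 \<le> N \<and> c * real N \<in> \<int>}"

text \<open>The number $K = cN$, for \<open>N \<in> admissible c\<close> and \<open>c \<ge> 0\<close>.\<close>

definition KN :: "real \<Rightarrow> nat \<Rightarrow> nat" where
  "KN c N = nat \<lfloor>c * real N\<rfloor>"

text \<open>The filter for limits $N \to \infty$ along admissible \<open>N\<close>.\<close>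

definition adm_filter :: "real \<Rightarrow> nat filter" where
  "adm_filter c = inf sequentially (principal (admissible c))"

end

theory Submission
  imports Defs "HOL-Combinatorics.Multiset_Permutations" "HOL-Real_Asymp.Real_Asymp"
begin

text \<open>
  The measure \<open>\<rho>\<^sub>\<alpha>\<close> has mean \<open>\<alpha> Z\<^sub>b\<^sub>-\<^sub>1(\<alpha>) / Z\<^sub>b(\<alpha>)\<close>, which lies between \<open>\<alpha>\<close> and \<open>\<alpha> + b\<close>;
  the intermediate value theorem on \<open>[c - b, c]\<close> gives existence of \<open>\<alpha>\<^sub>b(c)\<close>, and uniqueness
  holds because the symmetrised relative entropy of two members of the family with equal means
  vanishes.

  Exactly \<open>N! / \<Prod>j. \<nu>\<^sub>j! \<cdot> K! / \<Prod>j. (j!)^\<nu>\<^sub>j\<close> configurations have number density \<open>\<nu> / N\<close>. Stirling's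
  formula costs an error \<open>O(log N)\<close> for each of the at most \<open>m\<close> nonzero \<open>\<nu>\<^sub>j\<close>, hence, with
  \<open>L = log Z\<^sub>b(\<alpha>) - c log \<alpha>\<close>, the logarithm of this number divided by \<open>N\<close> is
  \<open>log K! / N + L - R(\<theta>\<^sub>\<nu> | \<rho>\<^sub>\<alpha>)\<close> up to \<open>O(m log N / N)\<close>, which vanishes as \<open>m\<^sup>2 / N \<rightarrow> 0\<close>. It remains
  to see that \<open>log |\<Omega>\<^sub>N\<^sub>,\<^sub>b\<^sub>,\<^sub>m| / N = log K! / N + L + o(1)\<close>. The upper bound is the generating function
  estimate \<open>|\<Omega>\<^sub>N\<^sub>,\<^sub>b\<^sub>,\<^sub>m| \<le> K! \<alpha>\<^sup>-\<^sup>K Z\<^sub>b(\<alpha>)\<^sup>N\<close>. For the lower bound, \<open>\<rho>\<^sub>\<alpha>\<close> is truncated at a large \<open>B\<close>,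
  its total mass and mean are restored by changing the masses of \<open>b\<close> and \<open>b + 1\<close>, and the
  result is rounded to a lattice point \<open>\<nu>\<close> with \<open>R(\<theta>\<^sub>\<nu> | \<rho>\<^sub>\<alpha>)\<close> small.
\<close>

section \<open>Counting configurations\<close>

text \<open>Written out as words f 1, ..., f n, such functions are the arrangements of the multiset
  in which each s has multiplicity \<open>c s\<close>, so the count is a multinomial coefficient. It
  is applied both to sites sorted by occupation number and to particles sorted by site.\<close>

lemma card_funs_prescribed_fibres:
  fixes S :: "'a set" and c :: "'a \<Rightarrow> nat"
  assumes S: "finite S" and c: "(\<Sum>s\<in>S. c s) = n"
  shows "real (card {f \<in> {1..n} \<rightarrow>\<^sub>E S. \<forall>s\<in>S. card {i\<in>{1..n}. f i = s} = c s}) =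
         fact n / (\<Prod>s\<in>S. fact (c s))"
proof -
  define M where "M = (\<Sum>s\<in>S. replicate_mset (c s) s)"
  have cM: "count M x = (if x \<in> S then c x else 0)" for x
    unfolding M_def using S by (induction S) auto
  have sM: "size M = n"
    unfolding M_def using c by (simp add: size_multiset_sum)
  have setM: "set_mset M \<subseteq> S" 
    using cM by (metis count_greater_zero_iff less_numeral_extra(3) subsetI)
  let ?F = "{f \<in> {1..n} \<rightarrow>\<^sub>E S. \<forall>s\<in>S. card {i\<in>{1..n}. f i = s} = c s}"
  have cm: "count (mset (map f [1..<Suc n])) s = card {i\<in>{1..n}. f i = s}" for f :: "nat \<Rightarrow> 'a" and s
  proof -
    have "count (mset (map f [1..<Suc n])) s = length (filter (\<lambda>i. f i = s) [1..<Suc n])"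
      by (simp only: count_mset count_list_eq_length_filter filter_map length_map o_def eq_commute)
    also have "\<dots> = card {i\<in>{1..n}. f i = s}"
      by (subst distinct_card[symmetric]) (auto intro!: arg_cong[where f = card])
    finally show ?thesis .
  qed
  have "bij_betw (\<lambda>f. map f [1..<Suc n]) ?F (permutations_of_multiset M)"
  proof (rule bij_betwI')
    fix f g assume f: "f \<in> ?F" and g: "g \<in> ?F"
    then have "f \<in> extensional {1..n}" "g \<in> extensional {1..n}"
      by (auto simp: PiE_def)
    then show "(map f [1..<Suc n] = map g [1..<Suc n]) = (f = g)"
      by (auto simp: map_eq_conv intro!: extensionalityI[of f "{1..n}" g])
  next
    fix f assume f: "f \<in> ?F"
    have "mset (map f [1..<Suc n]) = M"
    proof (rule multiset_eqI)
      fix x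
      show "count (mset (map f [1..<Suc n])) x = count M x"
        unfolding cm cM using f by (auto dest!: PiE_mem)
    qed
    then show "map f [1..<Suc n] \<in> permutations_of_multiset M"
      by (rule permutations_of_multisetI)
  next
    fix xs assume xs: "xs \<in> permutations_of_multiset M"
    then have m: "mset xs = M" by (rule permutations_of_multisetD)
    then have l: "length xs = n" using sM size_mset by metis
    \<comment> \<open>List positions start at 0 and arguments at 1, hence the shift;
      \<open>restrict\<close> supplies the default value outside {1..n} that the extensional
      function space demands.\<close>
    define f where "f = restrict (\<lambda>i. xs ! (i - 1)) {1..n}"
    have xs_eq: "xs = map f [1..<Suc n]"
      by (rule nth_equalityI) (auto simp: l f_def simp del: upt_Suc)
    have "f \<in> {1..n} \<rightarrow>\<^sub>E S"
    proof (rule PiE_I)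
      fix i assume i: "i \<in> {1..n}"
      then have "f i \<in> set (map f [1..<Suc n])" by (simp del: upt_Suc)
      then show "f i \<in> S" using m setM unfolding xs_eq[symmetric] by (metis set_mset_mset subsetD)
    qed (auto simp: f_def)
    moreover have "card {i\<in>{1..n}. f i = s} = c s" if "s \<in> S" for s
      unfolding cm[symmetric] xs_eq[symmetric] m cM using that by simp
    ultimately show "\<exists>f\<in>?F. xs = map f [1..<Suc n]" using xs_eq by blast
  qed
  then have "card ?F = card (permutations_of_multiset M)" by (rule bij_betw_same_card)
  also have "real \<dots> = fact n / (\<Prod>x\<in>set_mset M. fact (count M x))"
    using card_permutations_of_multiset[of M] by (simp add: real_of_nat_div sM)
  also have "(\<Prod>x\<in>set_mset M. fact (count M x)) = (\<Prod>s\<in>S. fact (c s) :: real)"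
    by (rule prod.mono_neutral_cong_left) (use S setM cM in \<open>auto simp: not_in_iff\<close>)
  finally show ?thesis .
qed

text \<open>The first factor counts the occupation vectors \<open>l \<mapsto> K\<^sub>l(\<omega>)\<close> with the given statistics,
  the second one the configurations with a given occupation vector.\<close>

lemma card_occ_num_eq:
  fixes S :: "nat set" and \<nu> :: "nat \<Rightarrow> nat"
  assumes S: "finite S" and N: "(\<Sum>j\<in>S. \<nu> j) = N" and K: "(\<Sum>j\<in>S. j * \<nu> j) = K"
  shows "real (card {\<omega> \<in> Omega N K. \<forall>j\<in>S. occ_num N K \<omega> j = \<nu> j}) =
         fact N / (\<Prod>j\<in>S. fact (\<nu> j)) * (fact K / (\<Prod>j\<in>S. fact j ^ \<nu> j))"
proof -
  define W where "W = {k \<in> {1..N} \<rightarrow>\<^sub>E S. \<forall>j\<in>S. card {l\<in>{1..N}. k l = j} = \<nu> j}"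
  let ?E = "{\<omega> \<in> Omega N K. \<forall>j\<in>S. occ_num N K \<omega> j = \<nu> j}"
  define D where "D = (\<lambda>k. {\<omega> \<in> {1..K} \<rightarrow>\<^sub>E {1..N}. \<forall>l\<in>{1..N}. card {i\<in>{1..K}. \<omega> i = l} = k l})"
  have finW: "finite W" unfolding W_def using S by (auto intro!: finite_PiE)
  have finD: "finite (D k)" for k unfolding D_def by (auto intro!: finite_PiE)
  \<comment> \<open>Grouping the sites by occupation number turns sums and products over sites into
    sums and products over j with multiplicity \<open>\<nu> j\<close>.\<close>
  have fib: "(\<Sum>l\<in>{1..N}. g (k l)) = (\<Sum>j\<in>S. \<nu> j * g j)" if "k \<in> W" for k and g :: "nat \<Rightarrow> nat"
  proof -
    have "(\<Sum>l\<in>{1..N}. g (k l)) = (\<Sum>j\<in>S. \<Sum>l\<in>{l. l \<in> {1..N} \<and> k l = j}. g (k l))"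
      using that S by (subst sum.group) (auto simp: W_def)
    also have "\<dots> = (\<Sum>j\<in>S. \<nu> j * g j)"
      using that by (intro sum.cong) (auto simp: W_def)
    finally show ?thesis .
  qed
  have fibp: "(\<Prod>l\<in>{1..N}. fact (k l)) = (\<Prod>j\<in>S. fact j ^ \<nu> j :: real)" if "k \<in> W" for k
  proof -
    have "(\<Prod>l\<in>{1..N}. fact (k l)) = (\<Prod>j\<in>S. \<Prod>l\<in>{l. l \<in> {1..N} \<and> k l = j}. fact (k l) :: real)"
      using that S by (subst prod.group) (auto simp: W_def)
    also have "\<dots> = (\<Prod>j\<in>S. fact j ^ \<nu> j)"
      using that by (intro prod.cong) (auto simp: W_def)
    finally show ?thesis .
  qed
  have E: "?E = (\<Union>k\<in>W. D k)"
  proof (intro equalityI subsetI)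
    fix \<omega> assume \<omega>: "\<omega> \<in> ?E"
    define k where "k = restrict (occ K \<omega>) {1..N}"
    have cnt: "card {l\<in>{1..N}. k l = j} = \<nu> j" if "j \<in> S" for j
    proof -
      have "{l\<in>{1..N}. k l = j} = {l \<in> {1..N}. occ K \<omega> l = j}" by (auto simp: k_def)
      then show ?thesis using \<omega> that by (auto simp: occ_num_def)
    qed
    \<comment> \<open>The sites with a value in S already number N, so no site has a value outside
      S.\<close>
    have "{l\<in>{1..N}. k l \<in> S} = (\<Union>j\<in>S. {l\<in>{1..N}. k l = j})" by auto
    then have "card {l\<in>{1..N}. k l \<in> S} = (\<Sum>j\<in>S. \<nu> j)"
      using S cnt by (simp, subst card_UN_disjoint) auto
    then have "{l\<in>{1..N}. k l \<in> S} = {1..N}"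
      by (intro card_subset_eq) (auto simp: N)
    then have "k l \<in> S" if "l \<in> {1..N}" for l using that by blast
    then have "k \<in> W" using cnt by (auto simp: W_def k_def restrict_PiE_iff)
    moreover have "\<omega> \<in> D k" using \<omega> by (auto simp: D_def Omega_def k_def occ_def)
    ultimately show "\<omega> \<in> (\<Union>k\<in>W. D k)" by blast
  next
    fix \<omega> assume "\<omega> \<in> (\<Union>k\<in>W. D k)"
    then obtain k where k: "k \<in> W" "\<omega> \<in> D k" by blast
    have "occ_num N K \<omega> j = \<nu> j" if "j \<in> S" for j
    proof -
      have "{l \<in> {1..N}. occ K \<omega> l = j} = {l\<in>{1..N}. k l = j}"
        using k(2) by (auto simp: D_def occ_def)
      then show ?thesis using k(1) that by (auto simp: W_def occ_num_def)
    qed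
    then show "\<omega> \<in> ?E" using k(2) by (auto simp: D_def Omega_def)
  qed
  have disj: "D k \<inter> D k' = {}" if kk: "k \<in> W" "k' \<in> W" "k \<noteq> k'" for k k'
  proof -
    obtain l where l: "l \<in> {1..N}" "k l \<noteq> k' l"
      using kk unfolding W_def by (metis (no_types, lifting) PiE_ext mem_Collect_eq)
    then show ?thesis unfolding D_def by fastforce
  qed
  have "card ?E = (\<Sum>k\<in>W. card (D k))"
    unfolding E by (intro card_UN_disjoint) (use finW finD disj in auto)
  also have "real \<dots> = (\<Sum>k\<in>W. fact K / (\<Prod>j\<in>S. fact j ^ \<nu> j))"
  proof -
    have "real (card (D k)) = fact K / (\<Prod>j\<in>S. fact j ^ \<nu> j)" if k: "k \<in> W" for k
    proof -
      have "(\<Sum>l\<in>{1..N}. k l) = K" using fib[OF k, of "\<lambda>x. x"] K by (simp add: mult.commute)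
      then have "real (card (D k)) = fact K / (\<Prod>l\<in>{1..N}. fact (k l))"
        unfolding D_def by (intro card_funs_prescribed_fibres) auto
      then show ?thesis by (simp only: fibp[OF k])
    qed
    then show ?thesis by simp
  qed
  also have "\<dots> = real (card W) * (fact K / (\<Prod>j\<in>S. fact j ^ \<nu> j))" by simp
  also have "real (card W) = fact N / (\<Prod>j\<in>S. fact (\<nu> j))"
    unfolding W_def by (rule card_funs_prescribed_fibres[OF S N])
  finally show ?thesis .
qed

text \<open>Up to the factor K!, the count is the coefficient of x^K in the N-th power of the sum of
  x^j / j!. All coefficients being nonnegative, it is at most the value of that power at any
  positive x, divided by x^K.\<close>

lemma card_occ_ge_le:
  fixes x :: real
  assumes x: "x > 0"
  shows "real (card {\<omega> \<in> Omega N K. \<forall>l\<in>{1..N}. b \<le> occ K \<omega> l}) \<le>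
         fact K / x ^ K * (\<Sum>j\<in>{b..K}. x ^ j / fact j) ^ N"
proof -
  define W where "W = {k \<in> {1..N} \<rightarrow>\<^sub>E {b..K}. (\<Sum>l\<in>{1..N}. k l) = K}"
  define D where "D = (\<lambda>k. {\<omega> \<in> {1..K} \<rightarrow>\<^sub>E {1..N}. \<forall>l\<in>{1..N}. card {i\<in>{1..K}. \<omega> i = l} = k l})"
  have finW: "finite W" unfolding W_def by (auto intro!: finite_PiE)
  have finD: "finite (D k)" for k unfolding D_def by (auto intro!: finite_PiE)
  have "{\<omega> \<in> Omega N K. \<forall>l\<in>{1..N}. b \<le> occ K \<omega> l} \<subseteq> (\<Union>k\<in>W. D k)"
  proof
    fix \<omega> assume \<omega>: "\<omega> \<in> {\<omega> \<in> Omega N K. \<forall>l\<in>{1..N}. b \<le> occ K \<omega> l}"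
    define k where "k = restrict (occ K \<omega>) {1..N}"
    have "occ K \<omega> l \<le> K" for l
      unfolding occ_def by (rule order_trans[OF card_mono[of "{1..K}"]]) auto
    moreover have "(\<Sum>l\<in>{1..N}. k l) = K"
    proof -
      have "(\<Sum>l\<in>{1..N}. k l) = (\<Sum>l\<in>{1..N}. \<Sum>i\<in>{i. i \<in> {1..K} \<and> \<omega> i = l}. 1)"
        by (intro sum.cong) (auto simp: k_def occ_def)
      also have "\<dots> = (\<Sum>i\<in>{1..K}. 1)"
        using \<omega> by (intro sum.group) (auto simp: Omega_def)
      finally show ?thesis by simp
    qed
    ultimately have "k \<in> W" using \<omega> by (auto simp: W_def k_def)
    moreover have "\<omega> \<in> D k" using \<omega> by (auto simp: D_def Omega_def k_def occ_def)
    ultimately show "\<omega> \<in> (\<Union>k\<in>W. D k)" by blast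
  qed
  then have "card {\<omega> \<in> Omega N K. \<forall>l\<in>{1..N}. b \<le> occ K \<omega> l} \<le> card (\<Union>k\<in>W. D k)"
    using finW finD by (intro card_mono) auto
  also have "\<dots> \<le> (\<Sum>k\<in>W. card (D k))" by (rule card_UN_le[OF finW])
  finally have "real (card {\<omega> \<in> Omega N K. \<forall>l\<in>{1..N}. b \<le> occ K \<omega> l}) \<le> (\<Sum>k\<in>W. real (card (D k)))"
    by (simp flip: of_nat_sum)
  also have "\<dots> = (\<Sum>k\<in>W. fact K / x ^ K * (\<Prod>l\<in>{1..N}. x ^ k l / fact (k l)))"
  proof (rule sum.cong[OF refl])
    fix k assume "k \<in> W"
    then have k: "(\<Sum>l\<in>{1..N}. k l) = K" by (simp add: W_def)
    then have "real (card (D k)) = fact K / (\<Prod>l\<in>{1..N}. fact (k l))"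
      unfolding D_def by (intro card_funs_prescribed_fibres) auto
    also have "\<dots> = fact K / x ^ K * ((\<Prod>l\<in>{1..N}. x ^ k l) / (\<Prod>l\<in>{1..N}. fact (k l)))"
      using x k by (simp add: power_sum[symmetric] del: One_nat_def)
    finally show "real (card (D k)) = fact K / x ^ K * (\<Prod>l\<in>{1..N}. x ^ k l / fact (k l))"
      by (simp add: prod_dividef)
  qed
  \<comment> \<open>Dropping the condition that the occupation numbers add up to K lets the sum
    factor over the sites.\<close>
  also have "\<dots> \<le> (\<Sum>k\<in>{1..N} \<rightarrow>\<^sub>E {b..K}. fact K / x ^ K * (\<Prod>l\<in>{1..N}. x ^ k l / fact (k l)))"
    using x by (intro sum_mono2)
      (auto simp: W_def intro!: finite_PiE mult_nonneg_nonneg divide_nonneg_nonneg prod_nonneg)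
  also have "\<dots> = fact K / x ^ K * (\<Sum>k\<in>{1..N} \<rightarrow>\<^sub>E {b..K}. \<Prod>l\<in>{1..N}. x ^ k l / fact (k l))"
    by (rule sum_distrib_left[symmetric])
  also have "(\<Sum>k\<in>{1..N} \<rightarrow>\<^sub>E {b..K}. \<Prod>l\<in>{1..N}. x ^ k l / fact (k l)) =
      (\<Sum>j\<in>{b..K}. x ^ j / fact j) ^ N"
    by (subst prod_sum_PiE[symmetric]) auto
  finally show ?thesis .
qed

section \<open>The tilted Poisson family\<close>

text \<open>The naturals are discrete, so the net of finite partial sums converges only by becoming
  constant beyond some finite X; enlarging X by one index cannot change the sum, hence every term
  outside X is 0.\<close>

lemma has_sum_nat_iff:
  fixes f :: "'a \<Rightarrow> nat"
  shows "(f has_sum n) A \<longleftrightarrow> finite {x\<in>A. f x \<noteq> 0} \<and> sum f {x\<in>A. f x \<noteq> 0} = n"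
proof
  assume "(f has_sum n) A"
  then have "\<forall>\<^sub>F F in finite_subsets_at_top A. sum f F = n"
    unfolding has_sum_def nhds_discrete filterlim_principal by simp
  then obtain X where X: "finite X" "X \<subseteq> A"
      "\<And>Y. finite Y \<Longrightarrow> X \<subseteq> Y \<Longrightarrow> Y \<subseteq> A \<Longrightarrow> sum f Y = n"
    unfolding eventually_finite_subsets_at_top by blast
  have nX: "sum f X = n" using X(1,2) by (intro X(3)) auto
  have sub: "{x\<in>A. f x \<noteq> 0} \<subseteq> X"
  proof
    fix x assume x: "x \<in> {x\<in>A. f x \<noteq> 0}"
    have "sum f (insert x X) = n" using X(1,2) x by (intro X(3)) auto
    with nX X(1) x show "x \<in> X" by (cases "x \<in> X") auto
  qed
  have "sum f {x\<in>A. f x \<noteq> 0} = sum f X"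
    using X(1,2) sub by (intro sum.mono_neutral_left) auto
  with nX finite_subset[OF sub X(1)]
  show "finite {x\<in>A. f x \<noteq> 0} \<and> sum f {x\<in>A. f x \<noteq> 0} = n" by blast
next
  assume *: "finite {x\<in>A. f x \<noteq> 0} \<and> sum f {x\<in>A. f x \<noteq> 0} = n"
  then have "(f has_sum n) {x\<in>A. f x \<noteq> 0}" by (auto intro: has_sum_finiteI)
  then show "(f has_sum n) A"
    by (subst has_sum_cong_neutral[where T = "{x\<in>A. f x \<noteq> 0}" and g = f]) auto
qed

lemma A_set_iff:
  "\<nu> \<in> A_set N K b M \<longleftrightarrow>
   \<nu> \<in> extensional {b..} \<and> finite {j\<in>{b..}. 1 \<le> \<nu> j} \<and> card {j\<in>{b..}. 1 \<le> \<nu> j} \<le> M \<and>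
   (\<Sum>j\<in>{j\<in>{b..}. 1 \<le> \<nu> j}. \<nu> j) = N \<and> (\<Sum>j\<in>{j\<in>{b..}. 1 \<le> \<nu> j}. j * \<nu> j) = K"
proof -
  \<comment> \<open>The two sums may have different supports: for b = 0 the index 0 counts towards
    the number of sites but not towards the first moment.\<close>
  define S T where "S = {j\<in>{b..}. 1 \<le> \<nu> j}" and "T = {j\<in>{b..}. j * \<nu> j \<noteq> 0}"
  have S: "{j\<in>{b..}. \<nu> j \<noteq> 0} = S" by (auto simp: S_def)
  have T: "T \<subseteq> S" by (auto simp: S_def T_def)
  have "(\<Sum>j\<in>T. j * \<nu> j) = (\<Sum>j\<in>S. j * \<nu> j)" if "finite S"
    using that T by (intro sum.mono_neutral_left) (auto simp: S_def T_def)
  moreover have "finite T" if "finite S" using that T finite_subset by blast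
  ultimately show ?thesis
    unfolding A_set_def num_pos_def has_sum_nat_iff PiE_iff mem_Collect_eq
    unfolding S S_def[symmetric] T_def[symmetric] by auto
qed

section \<open>Measures given by their components\<close>

lemma has_sum_diff:
  fixes f g :: "'a \<Rightarrow> real"
  assumes "(f has_sum s) A" "(g has_sum t) A"
  shows "((\<lambda>x. f x - g x) has_sum (s - t)) A"
  using has_sum_add[OF assms(1) has_sum_uminusI[OF assms(2)]] by simp

lemma measure_of_comps_prob_mean_iff:
  assumes nn: "\<And>j. b \<le> j \<Longrightarrow> 0 \<le> w j"
    and one: "(w has_sum 1) {b..}" and mean: "((\<lambda>j. w j * real j) has_sum s) {b..}"
  shows "measure_of_comps b w \<in> prob_mean b c \<longleftrightarrow> c = s"
proof -
  \<comment> \<open>For nonnegative terms an unordered sum converges absolutely, which makes it an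
    integral against counting measure.\<close>
  have abs: "integrable (count_space {b..}) f \<and> integral\<^sup>L (count_space {b..}) f = t"
    if "(f has_sum t) {b..}" "\<And>j. b \<le> j \<Longrightarrow> 0 \<le> f j" for f :: "nat \<Rightarrow> real" and t
  proof -
    have "(\<lambda>j. norm (f j)) summable_on {b..}"
      using that by (subst summable_on_cong[where g = f]) (auto simp: summable_on_def)
    then have a: "Infinite_Set_Sum.abs_summable_on f {b..}"
      by (simp only: abs_summable_equivalent)
    show ?thesis
      using a infsetsum_infsum[OF a] infsumI[OF that(1)]
      unfolding Infinite_Set_Sum.abs_summable_on_def infsetsum_def by simp
  qed
  let ?\<mu> = "measure_of_comps b w"
  note [simp] = measure_of_comps_def point_measure_def
  have AE: "AE x in count_space {b..}. 0 \<le> w x" by (auto simp: AE_count_space nn)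
  have "emeasure ?\<mu> (space ?\<mu>) = (\<integral>\<^sup>+x. ennreal (w x) \<partial>count_space {b..})"
    by (auto simp: emeasure_density intro!: nn_integral_cong)
  also have "\<dots> = 1"
    using abs[OF one nn] AE by (subst nn_integral_eq_integral) auto
  finally have "prob_space ?\<mu>" by (rule prob_spaceI)
  moreover have "integrable ?\<mu> real" "integral\<^sup>L ?\<mu> real = s"
    using abs[OF mean] nn AE by (auto simp: integrable_density integral_density)
  ultimately show ?thesis by (auto simp: prob_mean_def)
qed

lemma measure_measure_of_comps:
  assumes "b \<le> j" "0 \<le> w j"
  shows "measure (measure_of_comps b w) {j} = w j"
  using assms by (simp add: measure_def measure_of_comps_def emeasure_point_measure_finite2)

lemma measure_of_comps_cong:
  "(\<And>j. b \<le> j \<Longrightarrow> w j = w' j) \<Longrightarrow> measure_of_comps b w = measure_of_comps b w'"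
  unfolding measure_of_comps_def point_measure_def by (rule density_cong) (auto simp: AE_count_space)

section \<open>Normalisation and mean as functions of the parameter\<close>

lemma Z_has_sum:
  assumes "0 < \<alpha>"
  shows "((\<lambda>j. \<alpha> ^ j / fact j) has_sum Z b \<alpha>) {b..}"
proof -
  have "(\<lambda>j. \<alpha> ^ j / fact j) sums exp \<alpha>"
    using exp_converges[of \<alpha>] by (simp add: divide_inverse mult.commute)
  then have "((\<lambda>j. \<alpha> ^ j / fact j) has_sum exp \<alpha>) UNIV"
    using assms by (intro sums_nonneg_imp_has_sum) auto
  then have "((\<lambda>j. \<alpha> ^ j / fact j) has_sum exp \<alpha> - (\<Sum>j<b. \<alpha> ^ j / fact j)) (UNIV - {..<b})"
    by (intro has_sum_Diff) auto
  moreover have "UNIV - {..<b} = {b..}" by auto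
  ultimately show ?thesis by (simp add: Z_def)
qed

text \<open>The first term of the tail series; it yields positivity of \<open>Z\<close> and the
  upper bound \<alpha> + b for the mean.\<close>

lemma Z_ge:
  assumes "0 < \<alpha>"
  shows "\<alpha> ^ b / fact b \<le> Z b \<alpha>"
proof -
  have "((\<lambda>j. \<alpha> ^ j / fact j) has_sum \<alpha> ^ b / fact b) {b}" by (simp add: has_sum_finiteI)
  from has_sum_mono2[OF this Z_has_sum[OF assms]] show ?thesis using assms by auto
qed

lemma Z_pos: "0 < \<alpha> \<Longrightarrow> 0 < Z b \<alpha>"
  by (rule less_le_trans[OF _ Z_ge]) auto

text \<open>For \<open>b = 0\<close> the truncated difference \<open>b - 1 = 0\<close> gives the correct value \<open>\<alpha> * exp \<alpha>\<close>,
  as the summand at \<open>j = 0\<close> vanishes.\<close>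

lemma Z_mean_has_sum:
  assumes "0 < \<alpha>"
  shows "((\<lambda>j. \<alpha> ^ j / fact j * real j) has_sum \<alpha> * Z (b - 1) \<alpha>) {b..}"
proof -
  \<comment> \<open>For positive j, the factor j cancels against j!, leaving \<alpha> times the
    previous term; hence the shift by \<open>Suc\<close>.\<close>
  have "((\<lambda>i. \<alpha> * (\<alpha> ^ i / fact i)) has_sum \<alpha> * Z (b - 1) \<alpha>) {b - 1..}"
    by (intro has_sum_cmult_right Z_has_sum assms)
  also have "(\<lambda>i. \<alpha> * (\<alpha> ^ i / fact i)) = (\<lambda>j. \<alpha> ^ j / fact j * real j) \<circ> Suc"
    by (auto simp: fun_eq_iff divide_simps simp del: of_nat_Suc)
  finally have "((\<lambda>j. \<alpha> ^ j / fact j * real j) has_sum \<alpha> * Z (b - 1) \<alpha>) (Suc ` {b - 1..})"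
    by (subst has_sum_reindex) (simp, assumption)
  moreover have "j \<in> Suc ` {b - 1..}" if "j \<ge> b" "j \<noteq> 0" for j
    using that by (cases j) auto
  ultimately show ?thesis
    by (subst has_sum_cong_neutral[where T = "Suc ` {b - 1..}"
          and g = "\<lambda>j. \<alpha> ^ j / fact j * real j"]) force+
qed

lemma rho_comps:
  assumes "0 < \<alpha>"
  shows "((\<lambda>j. 1 / Z b \<alpha> * (\<alpha> ^ j / fact j)) has_sum 1) {b..}"
    and "((\<lambda>j. 1 / Z b \<alpha> * (\<alpha> ^ j / fact j) * real j) has_sum \<alpha> * Z (b - 1) \<alpha> / Z b \<alpha>) {b..}"
  using has_sum_cmult_right[OF Z_has_sum[OF assms, of b], where c = "1 / Z b \<alpha>"]
    has_sum_cmult_right[OF Z_mean_has_sum[OF assms, of b], where c = "1 / Z b \<alpha>"]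
    Z_pos[OF assms, of b]
  by (simp_all add: mult.assoc)

lemma rho_prob_mean_iff:
  assumes "0 < \<alpha>"
  shows "rho b \<alpha> \<in> prob_mean b c \<longleftrightarrow> \<alpha> * Z (b - 1) \<alpha> / Z b \<alpha> = c"
  unfolding rho_def using rho_comps[OF assms, of b] assms Z_pos[OF assms, of b]
  by (subst measure_of_comps_prob_mean_iff) auto

lemma rho_mean_exists:
  assumes "real b < c"
  shows "\<exists>\<alpha>>0. \<alpha> * Z (b - 1) \<alpha> / Z b \<alpha> = c"
proof -
  have bounds: "\<alpha> \<le> \<alpha> * Z (b - 1) \<alpha> / Z b \<alpha> \<and> \<alpha> * Z (b - 1) \<alpha> / Z b \<alpha> \<le> \<alpha> + real b" if "0 < \<alpha>" for \<alpha>
  proof (cases b)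
    case 0
    then show ?thesis using Z_pos[OF that, of 0] by simp
  next
    case (Suc d)
    \<comment> \<open>\<open>Z d\<close> exceeds \<open>Z (Suc d)\<close> by the single term
      \<alpha>^d / d!, and \<alpha> times this term is b \<alpha>^b / b!.\<close>
    have "\<alpha> * Z d \<alpha> = \<alpha> * Z b \<alpha> + real b * (\<alpha> ^ b / fact b)"
      by (simp add: Suc Z_def algebra_simps divide_simps del: of_nat_Suc)
    then have *: "\<alpha> * Z (b - 1) \<alpha> = \<alpha> * Z b \<alpha> + real b * (\<alpha> ^ b / fact b)"
      by (simp add: Suc)
    have "real b * (\<alpha> ^ b / fact b) \<le> real b * Z b \<alpha>"
      by (intro mult_left_mono Z_ge that) auto
    moreover have "0 \<le> real b * (\<alpha> ^ b / fact b)" using that by simp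
    ultimately show ?thesis
      unfolding * using Z_pos[OF that, of b] by (auto simp: field_simps)
  qed
  have c: "0 < c" "0 < c - real b" using assms by auto
  have "continuous_on {c - real b..c} (\<lambda>x. x * Z (b - 1) x / Z b x)"
  proof (intro continuous_on_divide ballI)
    show "Z b x \<noteq> 0" if "x \<in> {c - real b..c}" for x
      using Z_pos[of x b] c(2) that by auto
  qed (auto simp: Z_def intro!: continuous_intros)
  \<comment> \<open>At c - b the upper bound makes the mean at most c; at c the lower bound makes it
    at least c.\<close>
  then obtain x where x: "c - real b \<le> x" "x * Z (b - 1) x / Z b x = c"
    using IVT'[of "\<lambda>x. x * Z (b - 1) x / Z b x" "c - real b" c c] bounds[OF c(1)] bounds[OF c(2)]
    by auto
  moreover from x(1) c(2) have "0 < x" by linarith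
  ultimately show ?thesis by blast
qed

text \<open>Two members \<open>p\<close>, \<open>q\<close> of the family with equal means satisfy
  \<open>\<Sum>j. (p j - q j) * (ln (p j) - ln (q j)) = 0\<close>, as the logarithmic ratio is affine in \<open>j\<close>;
  since all summands are nonnegative, \<open>p = q\<close>.\<close>

lemma rho_mean_unique:
  assumes pos: "0 < \<alpha>" "0 < \<beta>"
    and eq: "\<alpha> * Z (b - 1) \<alpha> / Z b \<alpha> = \<beta> * Z (b - 1) \<beta> / Z b \<beta>"
  shows "\<alpha> = \<beta>"
proof -
  define p where "p j = 1 / Z b \<alpha> * (\<alpha> ^ j / fact j)" for j :: nat
  define q where "q j = 1 / Z b \<beta> * (\<beta> ^ j / fact j)" for j :: nat
  define A B where "A = ln \<alpha> - ln \<beta>" and "B = ln (Z b \<beta>) - ln (Z b \<alpha>)"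
  note Zp = Z_pos[OF pos(1), of b] Z_pos[OF pos(2), of b]
  have pq: "p j > 0" "q j > 0" for j using pos Zp by (auto simp: p_def q_def)
  have lnpq: "ln (p j) - ln (q j) = real j * A + B" for j
    using pos Zp by (simp add: p_def q_def A_def B_def ln_mult ln_div ln_realpow algebra_simps)
  have s1: "(p has_sum 1) {b..}" "(q has_sum 1) {b..}"
    using rho_comps(1)[OF pos(1)] rho_comps(1)[OF pos(2)] unfolding p_def q_def by auto
  define s where "s = \<alpha> * Z (b - 1) \<alpha> / Z b \<alpha>"
  have s2: "((\<lambda>j. p j * real j) has_sum s) {b..}" "((\<lambda>j. q j * real j) has_sum s) {b..}"
    using rho_comps(2)[OF pos(1), of b] rho_comps(2)[OF pos(2), of b] unfolding p_def q_def s_def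
    by (simp_all only: eq)
  have "((\<lambda>j. (p j * real j - q j * real j) * A + (p j - q j) * B) has_sum (s - s) * A + (1 - 1) * B) {b..}"
    by (intro has_sum_add has_sum_cmult_left has_sum_diff s1 s2)
  also have "(\<lambda>j. (p j * real j - q j * real j) * A + (p j - q j) * B) = 
      (\<lambda>j. (p j - q j) * (ln (p j) - ln (q j)))"
    unfolding lnpq by (simp add: algebra_simps)
  finally have hs: "((\<lambda>j. (p j - q j) * (ln (p j) - ln (q j))) has_sum 0) {b..}" by simp
  have nn: "(p j - q j) * (ln (p j) - ln (q j)) \<ge> 0" for j
    using pq[of j] by (cases "p j \<le> q j") (auto intro: mult_nonneg_nonneg mult_nonpos_nonpos)
  have "p j = q j" if "b \<le> j" for j
  proof -
    have "(p j - q j) * (ln (p j) - ln (q j)) = 0"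
      using nonneg_has_sum_le_0D[OF hs] nn that by blast
    then show ?thesis using pq[of j] by auto
  qed
  \<comment> \<open>The ratio of the masses at b + 1 and b is the parameter divided by b + 1, so
    equal laws have equal parameters.\<close>
  then have "p b = q b" "p (Suc b) = q (Suc b)" by auto
  moreover have "p (Suc b) = \<alpha> / real (Suc b) * p b" "q (Suc b) = \<beta> / real (Suc b) * q b"
    by (simp_all add: p_def q_def field_simps)
  ultimately show ?thesis using pq[of b] by simp
qed

section \<open>Entropy estimates at fixed size\<close>

text \<open>Stirling's formula up to a logarithmic error. The induction step rests on n ln((n+1)/n)
  \<le> 1 \<le> (n+1) ln((n+1)/n), both sides of which come from ln x \<le> x - 1.\<close>

lemma ln_fact_bounds:
  assumes "1 \<le> n"
  shows "real n * ln (real n) - real n \<le> ln (fact n)"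
    and "ln (fact n) \<le> real n * ln (real n) - real n + ln (real n) + 1"
proof -
  have "real n * ln (real n) - real n \<le> ln (fact n) \<and>
        ln (fact n) \<le> real n * ln (real n) - real n + ln (real n) + 1"
    using assms
  proof (induction n rule: nat_induct_at_least)
    case (Suc n)
    then have n: "real n > 0" by simp
    have f: "ln (fact (Suc n) :: real) = ln (real (Suc n)) + ln (fact n)"
      using n by (simp add: ln_mult del: of_nat_Suc)
    have d: "ln (real (Suc n)) - ln (real n) = ln (1 + 1 / real n)"
    proof -
      have "1 + 1 / real n = real (Suc n) / real n" using n by (simp add: field_simps)
      then show ?thesis using n by (simp add: ln_div del: of_nat_Suc)
    qed
    have "ln (1 + 1 / real n) \<le> 1 / real n" using n by (intro ln_add_one_self_le_self) auto
    then have u: "real n * (ln (real (Suc n)) - ln (real n)) \<le> 1"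
      unfolding d using n by (simp add: field_simps)
    have "ln (real n / real (Suc n)) \<le> real n / real (Suc n) - 1"
      using n by (intro ln_le_minus_one) auto
    then have "ln (real n) - ln (real (Suc n)) \<le> - (1 / real (Suc n))"
      using n by (simp add: ln_div field_simps)
    then have "real (Suc n) * (ln (real n) - ln (real (Suc n))) \<le> real (Suc n) * (- (1 / real (Suc n)))"
      by (intro mult_left_mono) auto
    then have l: "real (Suc n) * (ln (real (Suc n)) - ln (real n)) \<ge> 1"
      by (simp add: field_simps)
    show ?case using Suc.IH u l unfolding f by (simp add: algebra_simps)
  qed simp
  then show "real n * ln (real n) - real n \<le> ln (fact n)"
    "ln (fact n) \<le> real n * ln (real n) - real n + ln (real n) + 1" by auto
qed

text \<open>The linear Stirling terms cancel because the \<open>\<nu> j\<close> add up to N. The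
  remaining errors of N! and of the product of the factorials both lie between 0 and
  \<open>real M * (ln (real N) + 1)\<close> and enter with opposite signs, so their difference obeys
  the same bound.\<close>

lemma ln_multinomial_approx:
  fixes \<nu> :: "'a \<Rightarrow> nat"
  assumes S: "finite S" and pos: "\<And>j. j \<in> S \<Longrightarrow> 1 \<le> \<nu> j" and N: "(\<Sum>j\<in>S. \<nu> j) = N"
    and N1: "1 \<le> N" and M: "card S \<le> M"
  shows "\<bar>ln (fact N) - (\<Sum>j\<in>S. ln (fact (\<nu> j))) + (\<Sum>j\<in>S. real (\<nu> j) * ln (real (\<nu> j) / real N))\<bar>
    \<le> real M * (ln (real N) + 1)"
proof -
  let ?g = "\<lambda>n::nat. real n * ln (real n) - real n"
  have "S \<noteq> {}" using N N1 by auto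
  then have M1: "1 \<le> M" using S M by (metis One_nat_def Suc_leI card_gt_0_iff le_trans)
  have le: "\<nu> j \<le> N" if "j \<in> S" for j unfolding N[symmetric] using that S by (intro member_le_sum) auto
  have a: "ln (fact N) - ?g N \<in> {0..ln (real N) + 1}" using ln_fact_bounds[OF N1] by auto
  have "ln (fact (\<nu> j)) - ?g (\<nu> j) \<in> {0..ln (real N) + 1}" if "j \<in> S" for j
  proof -
    have "ln (real (\<nu> j)) \<le> ln (real N)" using le[OF that] pos[OF that] by simp
    then show ?thesis using ln_fact_bounds[OF pos[OF that]] by auto
  qed
  then have "(\<Sum>j\<in>S. ln (fact (\<nu> j)) - ?g (\<nu> j)) \<in> {0..(\<Sum>j\<in>S. ln (real N) + 1)}"
    using S by (auto intro!: sum_nonneg sum_mono simp del: sum_constant)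
  moreover have "(\<Sum>j\<in>S. ln (real N) + 1) \<le> real M * (ln (real N) + 1)"
    using M N1 by (auto intro!: mult_right_mono)
  moreover have "1 * (ln (real N) + 1) \<le> real M * (ln (real N) + 1)"
    using M1 N1 by (intro mult_right_mono) auto
  ultimately have b: "(\<Sum>j\<in>S. ln (fact (\<nu> j)) - ?g (\<nu> j)) \<in> {0..real M * (ln (real N) + 1)}"
    and M': "ln (real N) + 1 \<le> real M * (ln (real N) + 1)"
    by auto
  have rN: "(\<Sum>j\<in>S. real (\<nu> j)) = real N" using N by (metis of_nat_sum)
  have "(\<Sum>j\<in>S. real (\<nu> j) * ln (real (\<nu> j) / real N)) =
        (\<Sum>j\<in>S. ?g (\<nu> j) + real (\<nu> j) - real (\<nu> j) * ln (real N))"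
    using pos N1 by (intro sum.cong) (auto simp: ln_div algebra_simps dest!: pos)
  also have "\<dots> = (\<Sum>j\<in>S. ?g (\<nu> j)) - ?g N"
    unfolding sum.distrib sum_subtractf sum_distrib_right[symmetric] rN by simp
  finally have "ln (fact N) - (\<Sum>j\<in>S. ln (fact (\<nu> j))) + (\<Sum>j\<in>S. real (\<nu> j) * ln (real (\<nu> j) / real N))
      = (ln (fact N) - ?g N) - (\<Sum>j\<in>S. ln (fact (\<nu> j)) - ?g (\<nu> j))"
    by (simp add: sum_subtractf)
  then show ?thesis using a b M' by auto
qed

text \<open>By \<open>rel_entropy_theta_rho\<close> below, the subtracted sum differs from N times
  the relative entropy by a quantity that does not depend on \<open>\<nu>\<close>.\<close>

lemma ln_card_occ_num_approx:
  fixes \<nu> :: "nat \<Rightarrow> nat"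
  assumes S: "finite S" and pos: "\<And>j. j \<in> S \<Longrightarrow> 1 \<le> \<nu> j" and N: "(\<Sum>j\<in>S. \<nu> j) = N"
    and K: "(\<Sum>j\<in>S. j * \<nu> j) = K" and N1: "1 \<le> N" and M: "card S \<le> M"
  defines "E \<equiv> {\<omega> \<in> Omega N K. \<forall>j\<in>S. occ_num N K \<omega> j = \<nu> j}"
  shows "0 < card E"
    and "\<bar>ln (real (card E)) - (ln (fact K)
            - (\<Sum>j\<in>S. real (\<nu> j) * (ln (real (\<nu> j) / real N) + ln (fact j))))\<bar>
         \<le> real M * (ln (real N) + 1)"
proof -
  have card: "real (card E) = fact N / (\<Prod>j\<in>S. fact (\<nu> j)) * (fact K / (\<Prod>j\<in>S. fact j ^ \<nu> j))"
    unfolding E_def by (rule card_occ_num_eq[OF S N K])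
  have p: "0 < (\<Prod>j\<in>S. fact (\<nu> j) :: real)" "0 < (\<Prod>j\<in>S. fact j ^ \<nu> j :: real)"
    by (auto intro!: prod_pos)
  have "0 < real (card E)" unfolding card using p by (intro mult_pos_pos divide_pos_pos) auto
  then show "0 < card E" by simp
  have "ln (real (card E)) = ln (fact N) - (\<Sum>j\<in>S. ln (fact (\<nu> j))) +
          (ln (fact K) - (\<Sum>j\<in>S. real (\<nu> j) * ln (fact j)))"
    unfolding card using p S by (simp add: ln_mult ln_div ln_prod ln_realpow)
  then show "\<bar>ln (real (card E)) - (ln (fact K)
            - (\<Sum>j\<in>S. real (\<nu> j) * (ln (real (\<nu> j) / real N) + ln (fact j))))\<bar>
         \<le> real M * (ln (real N) + 1)"
    using ln_multinomial_approx[OF S pos N N1 M] by (simp add: distrib_left sum.distrib algebra_simps)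
qed

section \<open>Events of prescribed number density\<close>

lemma finite_Omega: "finite (Omega N K)"
  unfolding Omega_def by (auto intro!: finite_PiE)

lemma finite_Omega_bm: "finite (Omega_bm N K b M)"
  unfolding Omega_bm_def using finite_Omega by auto

text \<open>Since the numbers \<open>\<nu> j\<close>, \<open>j \<in> S\<close>, add up to \<open>N\<close>, prescribing \<open>N\<^sub>j(\<omega>) = \<nu> j\<close> on \<open>S\<close> leaves no
  site with an occupation number outside \<open>S\<close>.\<close>

lemma occ_in_support:
  assumes S: "finite S" and N: "(\<Sum>j\<in>S. \<nu> j) = N" 
    and \<nu>: "\<And>j. j \<in> S \<Longrightarrow> occ_num N K \<omega> j = \<nu> j" and l: "l \<in> {1..N}"
  shows "occ K \<omega> l \<in> S"
proof -
  have "{l\<in>{1..N}. occ K \<omega> l \<in> S} = (\<Union>j\<in>S. {l\<in>{1..N}. occ K \<omega> l = j})" by auto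
  also have "card \<dots> = (\<Sum>j\<in>S. card {l\<in>{1..N}. occ K \<omega> l = j})"
    using S by (intro card_UN_disjoint) auto
  also have "\<dots> = N" using \<nu> unfolding N[symmetric] by (intro sum.cong) (auto simp: occ_num_def)
  finally have "{l\<in>{1..N}. occ K \<omega> l \<in> S} = {1..N}"
    by (intro card_subset_eq) auto
  then show ?thesis using l by blast
qed

text \<open>All occupation numbers are forced into S, which lies above b and has at most M elements.
  Both constraints of \<open>Omega_bm\<close> are therefore automatic, and the event may be counted
  inside \<open>Omega\<close>.\<close>

lemma occ_num_eq_subset_Omega_bm:
  assumes S: "finite S" "S \<subseteq> {b..}" and N: "(\<Sum>j\<in>S. \<nu> j) = N" and M: "card S \<le> M"
  shows "{\<omega> \<in> Omega N K. \<forall>j\<in>S. occ_num N K \<omega> j = \<nu> j} \<subseteq> Omega_bm N K b M"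
proof
  fix \<omega> assume \<omega>: "\<omega> \<in> {\<omega> \<in> Omega N K. \<forall>j\<in>S. occ_num N K \<omega> j = \<nu> j}"
  have in_S: "occ K \<omega> l \<in> S" if "l \<in> {1..N}" for l
    using occ_in_support[OF S(1) N _ that] \<omega> by blast
  have "{j \<in> {b..}. 1 \<le> occ_num N K \<omega> j} \<subseteq> S"
  proof
    fix j assume "j \<in> {j \<in> {b..}. 1 \<le> occ_num N K \<omega> j}"
    then have "{l \<in> {1..N}. occ K \<omega> l = j} \<noteq> {}"
      unfolding occ_num_def by (metis (no_types, lifting) card.empty mem_Collect_eq not_one_le_zero)
    then show "j \<in> S" using in_S by blast
  qed
  then have "num_pos b (occ_num N K \<omega>) \<le> M"
    unfolding num_pos_def using card_mono[OF S(1)] M by (meson le_trans)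
  moreover have "b \<le> occ K \<omega> l" if "l \<in> {1..N}" for l
    using in_S[OF that] S(2) by auto
  ultimately show "\<omega> \<in> Omega_bm N K b M" using \<omega> by (auto simp: Omega_bm_def)
qed

text \<open>Equal measures agree on singletons, which gives equal counts after multiplying by N.
  Conversely, agreement on S settles all j, since off S both counts vanish.\<close>

lemma Theta_eq_theta_event:
  assumes \<nu>: "\<nu> \<in> A_set N K b M" and N1: "1 \<le> N"
  defines "S \<equiv> {j\<in>{b..}. 1 \<le> \<nu> j}"
  shows "{\<omega> \<in> space (P_unif N K b M). Theta N K b \<omega> = theta N b \<nu>} =
         {\<omega> \<in> Omega N K. \<forall>j\<in>S. occ_num N K \<omega> j = \<nu> j}"
proof -
  have S: "finite S" "card S \<le> M" "(\<Sum>j\<in>S. \<nu> j) = N" "S \<subseteq> {b..}"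
    using \<nu> unfolding A_set_iff S_def by auto
  have "Theta N K b \<omega> = theta N b \<nu> \<longleftrightarrow> (\<forall>j\<in>S. occ_num N K \<omega> j = \<nu> j)"
    if \<omega>: "\<omega> \<in> Omega N K" for \<omega>
  proof
    assume eq: "Theta N K b \<omega> = theta N b \<nu>"
    have "occ_num N K \<omega> j = \<nu> j" if "b \<le> j" for j
    proof -
      have "measure (Theta N K b \<omega>) {j} = measure (theta N b \<nu>) {j}" using eq by simp
      then show ?thesis
        unfolding Theta_def theta_def using that N1 by (simp add: measure_measure_of_comps)
    qed
    then show "\<forall>j\<in>S. occ_num N K \<omega> j = \<nu> j" by (auto simp: S_def)
  next
    assume eq: "\<forall>j\<in>S. occ_num N K \<omega> j = \<nu> j"
    have "occ_num N K \<omega> j = \<nu> j" if "b \<le> j" for j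
    proof (cases "j \<in> S")
      case False
      then have "{l \<in> {1..N}. occ K \<omega> l = j} = {}"
        using occ_in_support[OF S(1,3), of K \<omega>] eq by blast
      then have "occ_num N K \<omega> j = 0" unfolding occ_num_def by (metis card.empty)
      then show ?thesis using False that by (simp add: S_def)
    qed (use eq in auto)
    then show "Theta N K b \<omega> = theta N b \<nu>"
      unfolding Theta_def theta_def by (intro measure_of_comps_cong) auto
  qed
  moreover have "space (P_unif N K b M) = Omega_bm N K b M"
    by (simp add: P_unif_def space_uniform_count_measure)
  ultimately show ?thesis
    using occ_num_eq_subset_Omega_bm[OF S(1,4,3,2), of K] by (auto simp: Omega_bm_def)
qed

text \<open>Apart from - ln j!, the logarithm of the mass of \<open>rho\<close> at j is affine in j,
  so its average under \<open>theta\<close> depends only on total mass and mean; this produces the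
  constants \<open>ln (Z b \<alpha>) - c * ln \<alpha>\<close>.\<close>

lemma rel_entropy_theta_rho:
  assumes \<nu>: "\<nu> \<in> A_set N K b M" and N1: "1 \<le> N" and \<alpha>: "0 < \<alpha>" and K: "real K = c * real N"
  defines "S \<equiv> {j\<in>{b..}. 1 \<le> \<nu> j}"
  shows "rel_entropy b (theta N b \<nu>) (rho b \<alpha>) =
    ereal (1 / real N * (\<Sum>j\<in>S. real (\<nu> j) * (ln (real (\<nu> j) / real N) + ln (fact j)))
           + ln (Z b \<alpha>) - c * ln \<alpha>)"
proof -
  have S: "finite S" "(\<Sum>j\<in>S. \<nu> j) = N" "(\<Sum>j\<in>S. j * \<nu> j) = K" "S \<subseteq> {b..}"
    using \<nu> unfolding A_set_iff S_def by auto
  note Zp = Z_pos[OF \<alpha>, of b]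
  define r where "r j = 1 / Z b \<alpha> * (\<alpha> ^ j / fact j)" for j :: nat
  have rp: "r j > 0" for j using \<alpha> Zp by (simp add: r_def)
  have mt: "measure (theta N b \<nu>) {j} = real (\<nu> j) / real N" if "b \<le> j" for j
    unfolding theta_def using that by (simp add: measure_measure_of_comps)
  have mr: "measure (rho b \<alpha>) {j} = r j" if "b \<le> j" for j
    unfolding rho_def r_def[symmetric] using that rp[of j] by (intro measure_measure_of_comps) auto
  \<comment> \<open>On S both masses are positive, and elsewhere the summand is 0 by convention; the
    infinite case never occurs and a finite sum remains.\<close>
  have "rel_entropy b (theta N b \<nu>) (rho b \<alpha>) =
        (\<Sum>\<^sub>\<infinity>j\<in>S. ereal (real (\<nu> j) / real N * ln (real (\<nu> j) / real N / r j)))"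
    unfolding rel_entropy_def
  proof (rule infsum_cong_neutral)
    fix j assume "j \<in> {b..} \<inter> S"
    then show "(if measure (theta N b \<nu>) {j} = 0 then 0 else if measure (rho b \<alpha>) {j} = 0 then \<infinity>
      else ereal (measure (theta N b \<nu>) {j} * ln (measure (theta N b \<nu>) {j} / measure (rho b \<alpha>) {j})))
      = ereal (real (\<nu> j) / real N * ln (real (\<nu> j) / real N / r j))"
      using N1 rp[of j] by (simp add: mt mr S_def)
  qed (use S(4) in \<open>auto simp: mt S_def\<close>)
  also have "\<dots> = (\<Sum>j\<in>S. ereal (real (\<nu> j) / real N * ln (real (\<nu> j) / real N / r j)))"
    using S(1) by simp
  also have "\<dots> = ereal (\<Sum>j\<in>S. real (\<nu> j) / real N * ln (real (\<nu> j) / real N / r j))"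
    by simp
  also have "(\<Sum>j\<in>S. real (\<nu> j) / real N * ln (real (\<nu> j) / real N / r j)) =
    (\<Sum>j\<in>S. 1 / real N * (real (\<nu> j) * (ln (real (\<nu> j) / real N) + ln (fact j))) +
        (real (\<nu> j) * (ln (Z b \<alpha>) / real N) - real (j * \<nu> j) * (ln \<alpha> / real N)))"
  proof (rule sum.cong[OF refl])
    fix j assume "j \<in> S"
    then have "0 < real (\<nu> j) / real N" using N1 by (auto simp: S_def)
    then have "ln (real (\<nu> j) / real N / r j) = ln (real (\<nu> j) / real N) - ln (r j)"
      using rp[of j] by (metis ln_div less_numeral_extra(3))
    also have "ln (r j) = real j * ln \<alpha> - ln (fact j) - ln (Z b \<alpha>)"
      using \<alpha> Zp by (simp add: r_def ln_mult ln_div ln_realpow)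
    finally have lnq: "ln (real (\<nu> j) / real N / r j) =
        ln (real (\<nu> j) / real N) - (real j * ln \<alpha> - ln (fact j) - ln (Z b \<alpha>))" .
    show "real (\<nu> j) / real N * ln (real (\<nu> j) / real N / r j) =
        1 / real N * (real (\<nu> j) * (ln (real (\<nu> j) / real N) + ln (fact j))) +
        (real (\<nu> j) * (ln (Z b \<alpha>) / real N) - real (j * \<nu> j) * (ln \<alpha> / real N))"
      unfolding lnq by (simp add: algebra_simps add_divide_distrib diff_divide_distrib)
  qed
  also have "\<dots> = 1 / real N * (\<Sum>j\<in>S. real (\<nu> j) * (ln (real (\<nu> j) / real N) + ln (fact j))) +
      (real (\<Sum>j\<in>S. \<nu> j) * (ln (Z b \<alpha>) / real N) - real (\<Sum>j\<in>S. j * \<nu> j) * (ln \<alpha> / real N))"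
    unfolding sum.distrib sum_subtractf of_nat_sum sum_distrib_left sum_distrib_right ..
  also have "\<dots> = 1 / real N * (\<Sum>j\<in>S. real (\<nu> j) * (ln (real (\<nu> j) / real N) + ln (fact j)))
           + ln (Z b \<alpha>) - c * ln \<alpha>"
    unfolding S(2,3) K using N1 by simp
  finally show ?thesis .
qed

lemma theta_prob_mean:
  assumes \<nu>: "\<nu> \<in> A_set N K b M" and N1: "1 \<le> N" and K: "real K = c * real N"
  shows "theta N b \<nu> \<in> prob_mean b c"
proof -
  define S where "S = {j\<in>{b..}. 1 \<le> \<nu> j}"
  have S: "finite S" "(\<Sum>j\<in>S. \<nu> j) = N" "(\<Sum>j\<in>S. j * \<nu> j) = K" "S \<subseteq> {b..}"
    using \<nu> unfolding A_set_iff S_def by auto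
  have hs: "(f has_sum sum f S) {b..}" if "\<And>j. b \<le> j \<Longrightarrow> \<nu> j = 0 \<Longrightarrow> f j = 0" for f :: "nat \<Rightarrow> real"
    using has_sum_finite[OF S(1), of f] that S(4)
    by (subst has_sum_cong_neutral[where T = S and g = f]) (auto simp: S_def)
  have "(\<Sum>j\<in>S. real (\<nu> j) / real N) = 1"
    using S(2) N1 by (simp flip: sum_divide_distrib of_nat_sum)
  then have one: "((\<lambda>j. real (\<nu> j) / real N) has_sum 1) {b..}"
    using hs[of "\<lambda>j. real (\<nu> j) / real N"] by simp
  have "(\<Sum>j\<in>S. real (\<nu> j) / real N * real j) = real (\<Sum>j\<in>S. j * \<nu> j) / real N"
    unfolding of_nat_sum sum_divide_distrib by (intro sum.cong) auto
  also have "\<dots> = c" unfolding S(3) K using N1 by simp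
  finally have mean: "((\<lambda>j. real (\<nu> j) / real N * real j) has_sum c) {b..}"
    using hs[of "\<lambda>j. real (\<nu> j) / real N * real j"] by simp
  show ?thesis
    unfolding theta_def using measure_of_comps_prob_mean_iff[OF _ one mean] by simp
qed

text \<open>The restriction on the number of distinct occupation numbers is dropped, and the
  generating function estimate is taken at x = \<alpha>.\<close>

lemma ln_card_Omega_bm_le:
  assumes \<alpha>: "0 < \<alpha>" and ne: "0 < card (Omega_bm N K b M)"
  shows "ln (real (card (Omega_bm N K b M))) \<le> ln (fact K) + real N * ln (Z b \<alpha>) - real K * ln \<alpha>"
proof -
  note Zp = Z_pos[OF \<alpha>, of b]
  have "card (Omega_bm N K b M) \<le> card {\<omega> \<in> Omega N K. \<forall>l\<in>{1..N}. b \<le> occ K \<omega> l}"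
    using finite_Omega by (intro card_mono) (auto simp: Omega_bm_def)
  then have "real (card (Omega_bm N K b M)) \<le> fact K / \<alpha> ^ K * (\<Sum>j\<in>{b..K}. \<alpha> ^ j / fact j) ^ N"
    using card_occ_ge_le[OF \<alpha>, of N K b] by linarith
  also have "(\<Sum>j\<in>{b..K}. \<alpha> ^ j / fact j) \<le> Z b \<alpha>"
    using has_sum_mono2[OF has_sum_finite Z_has_sum[OF \<alpha>, of b], of "{b..K}"] \<alpha> by auto
  then have "fact K / \<alpha> ^ K * (\<Sum>j\<in>{b..K}. \<alpha> ^ j / fact j) ^ N \<le> fact K / \<alpha> ^ K * Z b \<alpha> ^ N"
    using \<alpha> by (intro mult_left_mono power_mono) (auto intro!: sum_nonneg)
  finally have "ln (real (card (Omega_bm N K b M))) \<le> ln (fact K / \<alpha> ^ K * Z b \<alpha> ^ N)"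
    using ne by (subst ln_le_cancel_iff) (use \<alpha> Zp in auto)
  also have "\<dots> = ln (fact K) + real N * ln (Z b \<alpha>) - real K * ln \<alpha>"
    using \<alpha> Zp by (simp add: ln_mult ln_div ln_realpow)
  finally show ?thesis .
qed

section \<open>Lattice approximation of the tilted law\<close>

text \<open>Splits off the two indices whose masses are altered in
  \<open>exists_truncated_law\<close>; the intervals {b + 2..B} eventually contain every finite set
  of the remaining indices.\<close>

lemma has_sum_imp_LIMSEQ_tail:
  fixes f :: "nat \<Rightarrow> real"
  assumes "(f has_sum s) {b..}"
  shows "(\<lambda>B. \<Sum>j\<in>{b + 2..B}. f j) \<longlonglongrightarrow> s - f b - f (b + 1)"
proof -
  have "(f has_sum (f b + f (b + 1))) {b, b + 1}" by (rule has_sum_finiteI) auto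
  then have "(f has_sum (s - (f b + f (b + 1)))) ({b..} - {b, b + 1})"
    by (intro has_sum_Diff assms) auto
  moreover have "{b..} - {b, b + 1} = {b + 2..}" by auto
  ultimately have hs: "(f has_sum (s - (f b + f (b + 1)))) {b + 2..}" by simp
  have "filterlim (\<lambda>B. {b + 2..B}) (finite_subsets_at_top {b + 2..}) sequentially"
    unfolding filterlim_finite_subsets_at_top
  proof safe
    fix X assume X: "finite X" "X \<subseteq> {b + 2..}"
    have "\<forall>\<^sub>F B in sequentially. Max (insert 0 X) \<le> B" by (rule eventually_ge_at_top)
    then show "\<forall>\<^sub>F B in sequentially. finite {b + 2..B} \<and> X \<subseteq> {b + 2..B} \<and> {b + 2..B} \<subseteq> {b + 2..}"
      by eventually_elim (use X in auto)
  qed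
  from filterlim_compose[OF hs[unfolded has_sum_def] this] show ?thesis
    by (simp add: algebra_simps)
qed

lemma sum_atLeastAtMost_head2:
  fixes f :: "nat \<Rightarrow> 'a::comm_monoid_add"
  assumes "b + 1 \<le> B"
  shows "(\<Sum>j\<in>{b..B}. f j) = f b + (f (b + 1) + (\<Sum>j\<in>{b + 2..B}. f j))"
proof -
  have "{b..B} = insert b (insert (b + 1) {b + 2..B})" using assms by auto
  then show ?thesis by simp
qed

text \<open>Two free masses match two linear constraints. As B grows they tend to the original
  masses at b and b + 1, so they become positive, and the entropy sum tends to its value at the full
  law, which is \<open>ln (Z b \<alpha>) - c * ln \<alpha>\<close>.\<close>

lemma exists_truncated_law:
  assumes \<alpha>: "0 < \<alpha>" and mean: "\<alpha> * Z (b - 1) \<alpha> / Z b \<alpha> = c" and e: "e > 0"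
  shows "\<exists>B q. b + 1 \<le> B \<and> (\<forall>j\<in>{b..B}. 0 < q j) \<and> (\<Sum>j\<in>{b..B}. q j) = 1 \<and>
           (\<Sum>j\<in>{b..B}. real j * q j) = c \<and>
           ln (Z b \<alpha>) - c * ln \<alpha> - e < - (\<Sum>j\<in>{b..B}. q j * (ln (q j) + ln (fact j)))"
proof -
  define r where "r j = 1 / Z b \<alpha> * (\<alpha> ^ j / fact j)" for j :: nat
  \<comment> \<open>Subtracting b times the mass constraint from the mean constraint eliminates the
    mass at b and gives b + 1 the coefficient 1.\<close>
  define q1 where "q1 B = c - real b - (\<Sum>j\<in>{b + 2..B}. (real j - real b) * r j)" for B
  define q0 where "q0 B = 1 - q1 B - (\<Sum>j\<in>{b + 2..B}. r j)" for B
  define g where "g j = r j * (ln (r j) + ln (fact j))" for j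
  note Zp = Z_pos[OF \<alpha>, of b]
  have rp: "r j > 0" for j using \<alpha> Zp by (simp add: r_def)
  have s1: "(r has_sum 1) {b..}" using rho_comps(1)[OF \<alpha>] unfolding r_def .
  have s2: "((\<lambda>j. r j * real j) has_sum c) {b..}"
    using rho_comps(2)[OF \<alpha>, of b] unfolding r_def mean .
  have s3: "((\<lambda>j. r j * real j - r j * real b) has_sum (c - 1 * real b)) {b..}"
    by (intro has_sum_diff has_sum_cmult_left s1 s2)
  have "((\<lambda>j. r j * real j * ln \<alpha> - r j * ln (Z b \<alpha>)) has_sum (c * ln \<alpha> - 1 * ln (Z b \<alpha>))) {b..}"
    by (intro has_sum_diff has_sum_cmult_left s1 s2)
  also have "(\<lambda>j. r j * real j * ln \<alpha> - r j * ln (Z b \<alpha>)) = g"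
  proof
    fix j
    have lnr: "ln (r j) = real j * ln \<alpha> - ln (fact j) - ln (Z b \<alpha>)"
      using \<alpha> Zp by (simp add: r_def ln_mult ln_div ln_realpow)
    show "r j * real j * ln \<alpha> - r j * ln (Z b \<alpha>) = g j"
      unfolding g_def lnr by (simp add: algebra_simps)
  qed
  finally have s4: "(g has_sum (c * ln \<alpha> - ln (Z b \<alpha>))) {b..}" by simp
  have l1: "q1 \<longlonglongrightarrow> r (b + 1)"
  proof -
    have "q1 \<longlonglongrightarrow> c - real b - ((c - 1 * real b) - (r b * real b - r b * real b)
            - (r (b + 1) * real (b + 1) - r (b + 1) * real b))"
      unfolding q1_def using has_sum_imp_LIMSEQ_tail[OF s3]
      by (intro tendsto_diff tendsto_const) (simp add: algebra_simps)
    then show ?thesis by (simp add: algebra_simps)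
  qed
  have l0: "q0 \<longlonglongrightarrow> r b"
  proof -
    have "q0 \<longlonglongrightarrow> 1 - r (b + 1) - (1 - r b - r (b + 1))"
      unfolding q0_def by (intro tendsto_diff tendsto_const l1 has_sum_imp_LIMSEQ_tail s1)
    then show ?thesis by simp
  qed
  have "(\<lambda>B. - (q0 B * (ln (q0 B) + ln (fact b)) + (q1 B * (ln (q1 B) + ln (fact (b + 1))) +
            (\<Sum>j\<in>{b + 2..B}. g j)))) \<longlonglongrightarrow>
        - (r b * (ln (r b) + ln (fact b)) + (r (b + 1) * (ln (r (b + 1)) + ln (fact (b + 1))) +
            ((c * ln \<alpha> - ln (Z b \<alpha>)) - g b - g (b + 1))))"
    using rp[of b] rp[of "b + 1"]
    by (intro tendsto_intros l0 l1 has_sum_imp_LIMSEQ_tail s4) auto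
  \<comment> \<open>In the limit the two altered terms are \<open>g b\<close> and
    \<open>g (b + 1)\<close>, which restore what the tail sum lacks.\<close>
  also have "- (r b * (ln (r b) + ln (fact b)) + (r (b + 1) * (ln (r (b + 1)) + ln (fact (b + 1))) +
            ((c * ln \<alpha> - ln (Z b \<alpha>)) - g b - g (b + 1)))) = ln (Z b \<alpha>) - c * ln \<alpha>"
    by (simp add: g_def)
  finally have lF: "(\<lambda>B. - (q0 B * (ln (q0 B) + ln (fact b)) + (q1 B * (ln (q1 B) + ln (fact (b + 1))) +
            (\<Sum>j\<in>{b + 2..B}. g j)))) \<longlonglongrightarrow> ln (Z b \<alpha>) - c * ln \<alpha>" .
  have "\<forall>\<^sub>F B in sequentially. b + 1 \<le> B \<and> 0 < q0 B \<and> 0 < q1 B \<and>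
      ln (Z b \<alpha>) - c * ln \<alpha> - e < - (q0 B * (ln (q0 B) + ln (fact b)) + 
        (q1 B * (ln (q1 B) + ln (fact (b + 1))) + (\<Sum>j\<in>{b + 2..B}. g j)))"
    using e by (intro eventually_conj eventually_ge_at_top order_tendstoD(1)[OF lF]
      order_tendstoD(1)[OF l0 rp] order_tendstoD(1)[OF l1 rp]) auto
  then obtain B where B: "b + 1 \<le> B" "0 < q0 B" "0 < q1 B"
      "ln (Z b \<alpha>) - c * ln \<alpha> - e < - (q0 B * (ln (q0 B) + ln (fact b)) + 
        (q1 B * (ln (q1 B) + ln (fact (b + 1))) + (\<Sum>j\<in>{b + 2..B}. g j)))"
    by (auto simp: eventually_sequentially)
  define q where "q j = (if j = b then q0 B else if j = b + 1 then q1 B else r j)" for j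
  have tail: "(\<Sum>j\<in>{b + 2..B}. h j (q j)) = (\<Sum>j\<in>{b + 2..B}. h j (r j))" for h :: "nat \<Rightarrow> real \<Rightarrow> real"
    by (rule sum.cong) (auto simp: q_def)
  have qb: "q b = q0 B" "q (b + 1) = q1 B" by (auto simp: q_def)
  note split = sum_atLeastAtMost_head2[OF B(1)]
  have "\<forall>j\<in>{b..B}. 0 < q j" using B rp by (auto simp: q_def)
  moreover have "(\<Sum>j\<in>{b..B}. q j) = 1"
    unfolding split tail[of "\<lambda>_ x. x"] qb by (simp add: q0_def)
  moreover have "(\<Sum>j\<in>{b..B}. real j * q j) = c"
  proof -
    have "(\<Sum>j\<in>{b + 2..B}. (real j - real b) * r j) =
          (\<Sum>j\<in>{b + 2..B}. real j * r j) - real b * (\<Sum>j\<in>{b + 2..B}. r j)"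
      by (simp add: algebra_simps sum_subtractf sum_distrib_left)
    then have "(\<Sum>j\<in>{b + 2..B}. real j * r j) = c - real b - q1 B + real b * (\<Sum>j\<in>{b + 2..B}. r j)"
      by (simp add: q1_def)
    then show ?thesis
      unfolding split tail[of "\<lambda>j x. real j * x"] qb by (simp add: q0_def algebra_simps)
  qed
  moreover have "ln (Z b \<alpha>) - c * ln \<alpha> - e < - (\<Sum>j\<in>{b..B}. q j * (ln (q j) + ln (fact j)))"
    unfolding split tail[of "\<lambda>j x. x * (ln x + ln (fact j))"] qb g_def[symmetric]
    by (rule B(4))
  ultimately show ?thesis using B(1) by blast
qed

section \<open>Limits along admissible sizes and rounding to lattice points\<close>

lemma KN_eq:
  assumes "N \<in> admissible c" "0 \<le> c"
  shows "real (KN c N) = c * real N"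
proof -
  from assms obtain z :: int where z: "c * real N = of_int z"
    by (auto simp: admissible_def elim: Ints_cases)
  moreover have "0 \<le> z" using z assms(2) by (metis mult_nonneg_nonneg of_int_0_le_iff of_nat_0_le_iff)
  ultimately show ?thesis by (simp add: KN_def)
qed

lemma eventually_adm_filter:
  "eventually P (adm_filter c) \<longleftrightarrow> (\<forall>\<^sub>F N in sequentially. N \<in> admissible c \<longrightarrow> P N)"
  by (simp add: adm_filter_def eventually_inf_principal)

lemma adm_filter_le_sequentially: "adm_filter c \<le> sequentially"
  by (simp add: adm_filter_def)

lemma tendsto_floor_div:
  assumes "(r::real) \<ge> 0"
  shows "(\<lambda>N. real (nat \<lfloor>real N * r\<rfloor>) / real N) \<longlonglongrightarrow> r"
proof (rule tendsto_sandwich)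
  show "\<forall>\<^sub>F N in sequentially. r - 1 / real N \<le> real (nat \<lfloor>real N * r\<rfloor>) / real N"
    using eventually_gt_at_top[of 0]
  proof eventually_elim
    case (elim N)
    have "real N * r - 1 \<le> real (nat \<lfloor>real N * r\<rfloor>)" using assms by linarith
    then have "(real N * r - 1) / real N \<le> real (nat \<lfloor>real N * r\<rfloor>) / real N"
      by (rule divide_right_mono) simp
    then show ?case using elim by (simp add: field_simps)
  qed
  show "\<forall>\<^sub>F N in sequentially. real (nat \<lfloor>real N * r\<rfloor>) / real N \<le> r"
    using eventually_gt_at_top[of 0]
  proof eventually_elim
    case (elim N)
    have "real (nat \<lfloor>real N * r\<rfloor>) \<le> real N * r" using assms by simp
    then show ?case using elim by (simp add: field_simps)
  qed
  show "(\<lambda>N. r - 1 / real N) \<longlonglongrightarrow> r" using tendsto_diff[OF tendsto_const lim_1_over_n] by force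
qed auto

text \<open>All occupation numbers except those of \<open>b\<close> and \<open>b + 1\<close> are obtained by rounding; the two
  remaining ones are then determined by the linear constraints.\<close>

lemma exists_lattice_approximation:
  assumes c: "0 \<le> c" and B: "b + 1 \<le> B" and q: "\<And>j. j \<in> {b..B} \<Longrightarrow> 0 < q j"
    and one: "(\<Sum>j\<in>{b..B}. q j) = 1" and mean: "(\<Sum>j\<in>{b..B}. real j * q j) = c"
  shows "\<exists>\<nu> :: nat \<Rightarrow> nat \<Rightarrow> nat.
     (\<forall>j\<in>{b..B}. ((\<lambda>N. real (\<nu> N j) / real N) \<longlongrightarrow> q j) (adm_filter c)) \<and>
     (\<forall>\<^sub>F N in adm_filter c. (\<forall>j\<in>{b..B}. 1 \<le> \<nu> N j) \<and>
        (\<Sum>j\<in>{b..B}. \<nu> N j) = N \<and> (\<Sum>j\<in>{b..B}. j * \<nu> N j) = KN c N)"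
proof -
  let ?F = "adm_filter c" and ?I = "{b + 2..B}"
  define n where "n N j = nat \<lfloor>real N * q j\<rfloor>" for N j
  \<comment> \<open>The same elimination as for the truncated law, carried out in the integers
    because for small N the two corrected counts can be negative.\<close>
  define n1 where "n1 N = int (KN c N) - int b * int N - (\<Sum>j\<in>?I. (int j - int b) * int (n N j))" for N
  define n0 where "n0 N = int N - n1 N - (\<Sum>j\<in>?I. int (n N j))" for N
  define \<nu> where "\<nu> N j = (if j = b then nat (n0 N) else if j = b + 1 then nat (n1 N) else n N j)" for N j
  have ln: "((\<lambda>N. real (n N j) / real N) \<longlongrightarrow> q j) ?F" if "j \<in> {b..B}" for j
    unfolding n_def using tendsto_floor_div q[OF that]
    by (intro tendsto_mono[OF adm_filter_le_sequentially]) auto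
  have adm: "\<forall>\<^sub>F N in ?F. N \<in> admissible c" by (simp add: eventually_adm_filter)
  note split = sum_atLeastAtMost_head2[OF B]
  have l1: "((\<lambda>N. of_int (n1 N) / real N) \<longlongrightarrow> q (b + 1)) ?F"
  proof -
    have "((\<lambda>N. c - real b - (\<Sum>j\<in>?I. (real j - real b) * (real (n N j) / real N))) \<longlongrightarrow>
            c - real b - (\<Sum>j\<in>?I. (real j - real b) * q j)) ?F"
      by (intro tendsto_intros ln) auto
    also have "c - real b - (\<Sum>j\<in>?I. (real j - real b) * q j) = q (b + 1)"
    proof -
      have "(\<Sum>j\<in>?I. (real j - real b) * q j) = (\<Sum>j\<in>?I. real j * q j) - real b * (\<Sum>j\<in>?I. q j)"
        by (simp add: algebra_simps sum_subtractf sum_distrib_left)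
      also have "\<dots> = c - real b * q b - real (b + 1) * q (b + 1) - real b * (1 - q b - q (b + 1))"
      proof -
        have "(\<Sum>j\<in>?I. q j) = 1 - q b - q (b + 1)"
          "(\<Sum>j\<in>?I. real j * q j) = c - real b * q b - real (b + 1) * q (b + 1)"
          using one mean unfolding split by linarith+
        then show ?thesis by (simp only:)
      qed
      finally show ?thesis by (simp add: algebra_simps)
    qed
    finally show ?thesis
    proof (rule Lim_transform_eventually)
      show "\<forall>\<^sub>F N in ?F. c - real b - (\<Sum>j\<in>?I. (real j - real b) * (real (n N j) / real N)) =
          of_int (n1 N) / real N"
        using adm
      proof eventually_elim
        case (elim N)
        then have "real N > 0" by (auto simp: admissible_def)
        then show ?case
          by (simp add: n1_def KN_eq[OF elim c] diff_divide_distrib sum_divide_distrib)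
      qed
    qed
  qed
  have l0: "((\<lambda>N. of_int (n0 N) / real N) \<longlongrightarrow> q b) ?F"
  proof -
    have "((\<lambda>N. 1 - of_int (n1 N) / real N - (\<Sum>j\<in>?I. real (n N j) / real N)) \<longlongrightarrow>
            1 - q (b + 1) - (\<Sum>j\<in>?I. q j)) ?F"
      by (intro tendsto_intros ln l1) auto
    also have "1 - q (b + 1) - (\<Sum>j\<in>?I. q j) = q b" using one unfolding split by simp
    finally show ?thesis
    proof (rule Lim_transform_eventually)
      show "\<forall>\<^sub>F N in ?F. 1 - of_int (n1 N) / real N - (\<Sum>j\<in>?I. real (n N j) / real N) =
          of_int (n0 N) / real N"
        using adm
      proof eventually_elim
        case (elim N)
        then have "real N > 0" by (auto simp: admissible_def)
        then show ?case by (simp add: n0_def diff_divide_distrib sum_divide_distrib)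
      qed
    qed
  qed
  have pos: "\<forall>\<^sub>F N in ?F. 0 < f N" if "((\<lambda>N. of_int (f N) / real N) \<longlongrightarrow> q j) ?F" "j \<in> {b..B}" for f j
    using order_tendstoD(1)[OF that(1) q[OF that(2)]]
    by eventually_elim (auto simp: zero_less_divide_iff)
  \<comment> \<open>The limits \<open>q b\<close> and \<open>q (b + 1)\<close> are positive, so for
    large N the conversion by \<open>nat\<close> in \<open>\<nu>\<close> loses nothing.\<close>
  have p0: "\<forall>\<^sub>F N in ?F. 0 < n0 N" and p1: "\<forall>\<^sub>F N in ?F. 0 < n1 N"
    using pos[OF l0] pos[OF l1] B by auto
  have pI: "\<forall>\<^sub>F N in ?F. \<forall>j\<in>?I. 0 < int (n N j)"
  proof (rule eventually_ball_finite)
    show "\<forall>j\<in>?I. \<forall>\<^sub>F N in ?F. 0 < int (n N j)"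
      using pos[of "\<lambda>N. int (n N j)" j for j] ln by auto
  qed simp
  have lim: "((\<lambda>N. real (\<nu> N j) / real N) \<longlongrightarrow> q j) ?F" if j: "j \<in> {b..B}" for j
  proof -
    consider "j = b" | "j = b + 1" | "j \<noteq> b" "j \<noteq> b + 1" by blast
    then show ?thesis
    proof cases
      case 1
      show ?thesis
        by (rule Lim_transform_eventually[OF l0[folded 1]], rule eventually_mono[OF p0])
           (simp add: \<nu>_def 1)
    next
      case 2
      show ?thesis
        by (rule Lim_transform_eventually[OF l1[folded 2]], rule eventually_mono[OF p1])
           (simp add: \<nu>_def 2)
    next
      case 3
      then show ?thesis using ln[OF j] by (simp add: \<nu>_def)
    qed
  qed
  have "\<forall>\<^sub>F N in ?F. (\<forall>j\<in>{b..B}. 1 \<le> \<nu> N j) \<and>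
        (\<Sum>j\<in>{b..B}. \<nu> N j) = N \<and> (\<Sum>j\<in>{b..B}. j * \<nu> N j) = KN c N"
    using p0 p1 pI
  proof eventually_elim
    case (elim N)
    have tail: "(\<Sum>j\<in>?I. h j (\<nu> N j)) = (\<Sum>j\<in>?I. h j (n N j))" for h :: "nat \<Rightarrow> nat \<Rightarrow> int"
      by (rule sum.cong) (auto simp: \<nu>_def)
    have vb: "int (\<nu> N b) = n0 N" "int (\<nu> N (b + 1)) = n1 N"
      using elim by (auto simp: \<nu>_def)
    have "int (\<Sum>j\<in>{b..B}. \<nu> N j) = int N"
      unfolding of_nat_sum unfolding split vb tail[of "\<lambda>_. int"] by (simp add: n0_def)
    moreover have "int (\<Sum>j\<in>{b..B}. j * \<nu> N j) = int (KN c N)"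
    proof -
      have "(\<Sum>j\<in>?I. (int j - int b) * int (n N j)) =
            (\<Sum>j\<in>?I. int j * int (n N j)) - int b * (\<Sum>j\<in>?I. int (n N j))"
        by (simp add: algebra_simps sum_subtractf sum_distrib_left)
      then have "(\<Sum>j\<in>?I. int j * int (n N j)) =
            int (KN c N) - int b * int N - n1 N + int b * (\<Sum>j\<in>?I. int (n N j))"
        by (simp add: n1_def)
      then show ?thesis
        unfolding of_nat_sum of_nat_mult unfolding split vb tail[of "\<lambda>j x. int j * int x"]
        by (simp add: n0_def algebra_simps)
    qed
    moreover have "1 \<le> \<nu> N j" if "j \<in> {b..B}" for j
      using elim that by (auto simp: \<nu>_def Suc_le_eq)
    ultimately show ?case by (simp only: of_nat_eq_iff) blast
  qed
  with lim show ?thesis by blast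
qed

section \<open>The large deviation estimate\<close>

text \<open>The expression is the product of m / sqrt N, the root of the quantity assumed to vanish,
  and (ln N + 1) / sqrt N.\<close>

lemma fluctuation_error_tendsto_0:
  assumes "((\<lambda>N. (real (m N))\<^sup>2 / real N) \<longlongrightarrow> 0) F" and F: "F \<le> sequentially"
  shows "((\<lambda>N. real (m N) * (ln (real N) + 1) / real N) \<longlongrightarrow> 0) F"
proof -
  have "((\<lambda>N. sqrt ((real (m N))\<^sup>2 / real N)) \<longlongrightarrow> sqrt 0) F"
    by (intro tendsto_intros assms)
  moreover have "(\<lambda>N. (ln (real N) + 1) / sqrt (real N)) \<longlonglongrightarrow> 0" by real_asymp
  then have "((\<lambda>N. (ln (real N) + 1) / sqrt (real N)) \<longlongrightarrow> 0) F" by (rule tendsto_mono[OF F])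
  ultimately have "((\<lambda>N. sqrt ((real (m N))\<^sup>2 / real N) * ((ln (real N) + 1) / sqrt (real N)))
      \<longlongrightarrow> sqrt 0 * 0) F" by (rule tendsto_mult)
  then show ?thesis by (simp add: real_sqrt_divide)
qed

text \<open>A single density class is already large enough: the one of lattice points approximating
  the truncated law. Its support {b..B} is fixed, so it is permitted as soon as \<open>m N\<close>
  exceeds B.\<close>

lemma ln_card_Omega_bm_ge:
  assumes b: "real b < c" and \<alpha>: "0 < \<alpha>" "\<alpha> * Z (b - 1) \<alpha> / Z b \<alpha> = c" and e: "0 < e"
    and m: "filterlim m at_top (adm_filter c)"
    and err: "((\<lambda>N. real (m N) * (ln (real N) + 1) / real N) \<longlongrightarrow> 0) (adm_filter c)"
  shows "\<forall>\<^sub>F N in adm_filter c. 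
    ln (fact (KN c N)) + real N * (ln (Z b \<alpha>) - c * ln \<alpha> - e)
      \<le> ln (real (card (Omega_bm N (KN c N) b (m N))))"
proof -
  let ?F = "adm_filter c" and ?L = "ln (Z b \<alpha>) - c * ln \<alpha>"
  obtain B q where B: "b + 1 \<le> B" "\<forall>j\<in>{b..B}. 0 < q j" "(\<Sum>j\<in>{b..B}. q j) = 1"
      "(\<Sum>j\<in>{b..B}. real j * q j) = c"
      "?L - e / 2 < - (\<Sum>j\<in>{b..B}. q j * (ln (q j) + ln (fact j)))"
    using exists_truncated_law[OF \<alpha>, of "e / 2"] e by auto
  have "\<exists>\<nu> :: nat \<Rightarrow> nat \<Rightarrow> nat.
     (\<forall>j\<in>{b..B}. ((\<lambda>N. real (\<nu> N j) / real N) \<longlongrightarrow> q j) ?F) \<and>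
     (\<forall>\<^sub>F N in ?F. (\<forall>j\<in>{b..B}. 1 \<le> \<nu> N j) \<and>
        (\<Sum>j\<in>{b..B}. \<nu> N j) = N \<and> (\<Sum>j\<in>{b..B}. j * \<nu> N j) = KN c N)"
    using b B by (intro exists_lattice_approximation) auto
  then obtain \<nu> :: "nat \<Rightarrow> nat \<Rightarrow> nat" where
    lim: "\<And>j. j \<in> {b..B} \<Longrightarrow> ((\<lambda>N. real (\<nu> N j) / real N) \<longlongrightarrow> q j) ?F" and
    \<nu>: "\<forall>\<^sub>F N in ?F. (\<forall>j\<in>{b..B}. 1 \<le> \<nu> N j) \<and>
        (\<Sum>j\<in>{b..B}. \<nu> N j) = N \<and> (\<Sum>j\<in>{b..B}. j * \<nu> N j) = KN c N"
    by blast
  have "((\<lambda>N. - (\<Sum>j\<in>{b..B}. real (\<nu> N j) / real N * (ln (real (\<nu> N j) / real N) + ln (fact j))))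
      \<longlongrightarrow> - (\<Sum>j\<in>{b..B}. q j * (ln (q j) + ln (fact j)))) ?F"
    by (intro tendsto_intros lim) (use B(2) in force)+
  \<comment> \<open>The strict inequality for q passes to its lattice approximations for large N;
    the other half of e absorbs the Stirling error.\<close>
  from order_tendstoD(1)[OF this B(5)] order_tendstoD(2)[OF err, of "e / 2"] \<nu>
    filterlim_at_top[THEN iffD1, OF m, rule_format, of "B + 1"]
  have "\<forall>\<^sub>F N in ?F. ?L - e / 2 <
        - (\<Sum>j\<in>{b..B}. real (\<nu> N j) / real N * (ln (real (\<nu> N j) / real N) + ln (fact j))) \<and>
      real (m N) * (ln (real N) + 1) / real N < e / 2 \<and> (\<forall>j\<in>{b..B}. 1 \<le> \<nu> N j) \<and>
      (\<Sum>j\<in>{b..B}. \<nu> N j) = N \<and> (\<Sum>j\<in>{b..B}. j * \<nu> N j) = KN c N \<and> B + 1 \<le> m N \<and> 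
      N \<in> admissible c"
    using e by (auto simp: eventually_conj_iff eventually_adm_filter)
  then show ?thesis
  proof eventually_elim
    case (elim N)
    define K where "K = KN c N"
    define E where "E = {\<omega> \<in> Omega N K. \<forall>j\<in>{b..B}. occ_num N K \<omega> j = \<nu> N j}"
    have N: "1 \<le> N" using elim by (auto simp: admissible_def)
    have cm: "card {b..B} \<le> m N" using elim by auto
    have E: "0 < card E" "\<bar>ln (real (card E)) - (ln (fact K)
            - (\<Sum>j\<in>{b..B}. real (\<nu> N j) * (ln (real (\<nu> N j) / real N) + ln (fact j))))\<bar>
         \<le> real (m N) * (ln (real N) + 1)"
      unfolding E_def
      by (intro ln_card_occ_num_approx; use elim N cm in \<open>auto simp: K_def\<close>)+
    have "E \<subseteq> Omega_bm N K b (m N)"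
      unfolding E_def using elim cm by (intro occ_num_eq_subset_Omega_bm) auto
    then have "card E \<le> card (Omega_bm N K b (m N))" using finite_Omega_bm by (rule card_mono[rotated])
    then have le: "ln (real (card E)) \<le> ln (real (card (Omega_bm N K b (m N))))"
      using E(1) by simp
    have "real N * (?L - e / 2) \<le> real N *
        - (\<Sum>j\<in>{b..B}. real (\<nu> N j) / real N * (ln (real (\<nu> N j) / real N) + ln (fact j)))"
      using elim by (intro mult_left_mono) auto
    also have "\<dots> = - (\<Sum>j\<in>{b..B}. real (\<nu> N j) * (ln (real (\<nu> N j) / real N) + ln (fact j)))"
      using N by (simp add: sum_distrib_left)
    finally have 1: "real N * (?L - e / 2) \<le> \<dots>" .
    have 2: "real (m N) * (ln (real N) + 1) \<le> e / 2 * real N"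
      using elim N by (simp add: pos_divide_less_eq)
    have "ln (fact K) + real N * (?L - e) = ln (fact K) + real N * (?L - e / 2) - e / 2 * real N"
      by (simp add: algebra_simps)
    also have "\<dots> \<le> ln (real (card E))" using 1 2 E(2) by linarith
    finally show ?case using le unfolding K_def by linarith
  qed
qed

lemma ex1_rho_prob_mean:
  assumes \<alpha>: "0 < \<alpha>" "\<alpha> * Z (b - 1) \<alpha> / Z b \<alpha> = c"
  shows "\<exists>!\<alpha>. 0 < \<alpha> \<and> rho b \<alpha> \<in> prob_mean b c" and "alpha b c = \<alpha>"
proof -
  have 1: "0 < \<alpha> \<and> rho b \<alpha> \<in> prob_mean b c" using \<alpha> rho_prob_mean_iff by blast
  have 2: "\<beta> = \<alpha>" if "0 < \<beta> \<and> rho b \<beta> \<in> prob_mean b c" for \<beta>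
    using that \<alpha> rho_mean_unique rho_prob_mean_iff by metis
  show "\<exists>!\<alpha>. 0 < \<alpha> \<and> rho b \<alpha> \<in> prob_mean b c" using 1 2 by (rule ex1I)
  show "alpha b c = \<alpha>" unfolding alpha_def using 1 2 by (rule the_equality)
qed

lemma local_large_deviation_estimate:
  assumes b: "real b < c" and \<alpha>: "0 < \<alpha>" "\<alpha> * Z (b - 1) \<alpha> / Z b \<alpha> = c"
    and m: "filterlim m at_top (adm_filter c)"
    and m2: "((\<lambda>N. (real (m N))\<^sup>2 / real N) \<longlongrightarrow> 0) (adm_filter c)"
  shows "\<exists>\<epsilon> :: nat \<Rightarrow> (nat \<Rightarrow> nat) \<Rightarrow> real.
            (\<forall>N\<in>admissible c. \<forall>\<nu>\<in>A_set N (KN c N) b (m N).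
               let P = P_unif N (KN c N) b (m N);
                   p = measure P {\<omega> \<in> space P. Theta N (KN c N) b \<omega> = theta N b \<nu>}
               in 0 < p \<and>
                  ereal (1 / real N * ln p) =
                    - rel_entropy b (theta N b \<nu>) (rho b \<alpha>) + ereal (\<epsilon> N \<nu>)) \<and>
            (\<forall>e>0. \<forall>\<^sub>F N in adm_filter c.
               \<forall>\<nu>\<in>A_set N (KN c N) b (m N). \<bar>\<epsilon> N \<nu>\<bar> < e)"
proof -
  define L where "L = ln (Z b \<alpha>) - c * ln \<alpha>"
  define pr where "pr N \<nu> = measure (P_unif N (KN c N) b (m N))
      {\<omega> \<in> space (P_unif N (KN c N) b (m N)). Theta N (KN c N) b \<omega> = theta N b \<nu>}" for N \<nu>
  define S where "S \<nu> = {j\<in>{b..}. 1 \<le> (\<nu> j :: nat)}" for \<nu>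
  define H where "H N \<nu> = (\<Sum>j\<in>S \<nu>. real (\<nu> j) * (ln (real (\<nu> j) / real N) + ln (fact j)))" for N \<nu>
  \<comment> \<open>The error is defined as the exact defect, so the identity holds by construction
    and only its uniform smallness needs an argument.\<close>
  define \<epsilon> where "\<epsilon> N \<nu> = 1 / real N * ln (pr N \<nu>) + (1 / real N * H N \<nu> + L)" for N \<nu>
  define W where "W N = card (Omega_bm N (KN c N) b (m N))" for N
  define err where "err N = real (m N) * (ln (real N) + 1)" for N
  have K: "real (KN c N) = c * real N" if "N \<in> admissible c" for N
    by (rule KN_eq) (use that b in auto)
  \<comment> \<open>The term \<open>H N \<nu>\<close> occurs with opposite signs in the
    log-probability and in the entropy. Hence \<open>real N * \<epsilon> N \<nu>\<close> equals
    \<open>ln (fact (KN c N)) + real N * L - ln (real (W N))\<close> up to \<open>err N\<close>, a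
    bound free of \<open>\<nu>\<close>; this is the source of uniformity.\<close>
  have main: "0 < pr N \<nu> \<and> rel_entropy b (theta N b \<nu>) (rho b \<alpha>) = ereal (1 / real N * H N \<nu> + L) \<and>
      0 < W N \<and> \<bar>ln (pr N \<nu>) + ln (real (W N)) - (ln (fact (KN c N)) - H N \<nu>)\<bar> \<le> err N"
    if N: "N \<in> admissible c" and \<nu>: "\<nu> \<in> A_set N (KN c N) b (m N)" for N \<nu>
  proof -
    have N1: "1 \<le> N" using N by (auto simp: admissible_def)
    have S: "finite (S \<nu>)" "card (S \<nu>) \<le> m N" "(\<Sum>j\<in>S \<nu>. \<nu> j) = N" 
        "(\<Sum>j\<in>S \<nu>. j * \<nu> j) = KN c N" "S \<nu> \<subseteq> {b..}" "\<And>j. j \<in> S \<nu> \<Longrightarrow> 1 \<le> \<nu> j"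
      using \<nu> unfolding A_set_iff S_def by auto
    define E where "E = {\<omega> \<in> Omega N (KN c N). \<forall>j\<in>S \<nu>. occ_num N (KN c N) \<omega> j = \<nu> j}"
    have E: "0 < card E" "\<bar>ln (real (card E)) - (ln (fact (KN c N)) - H N \<nu>)\<bar> \<le> err N"
      unfolding E_def H_def err_def using ln_card_occ_num_approx[OF S(1,6,3,4) N1 S(2)] by blast+
    have sub: "E \<subseteq> Omega_bm N (KN c N) b (m N)"
      unfolding E_def by (rule occ_num_eq_subset_Omega_bm[OF S(1,5,3,2)])
    have W: "0 < W N"
      unfolding W_def using card_mono[OF finite_Omega_bm sub] E(1) by linarith
    have "pr N \<nu> = measure (P_unif N (KN c N) b (m N)) E"
      unfolding pr_def E_def S_def by (subst Theta_eq_theta_event[OF \<nu> N1]) simp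
    also have "\<dots> = real (card E) / real (W N)"
      unfolding P_unif_def W_def by (rule measure_uniform_count_measure[OF finite_Omega_bm sub])
    finally have pr: "pr N \<nu> = real (card E) / real (W N)" .
    then have "ln (pr N \<nu>) + ln (real (W N)) = ln (real (card E))"
      using E(1) W by (simp add: ln_div)
    then show ?thesis
      using E W pr rel_entropy_theta_rho[OF \<nu> N1 \<alpha>(1) K[OF N]] by (simp add: H_def S_def L_def)
  qed
  have "\<forall>\<^sub>F N in adm_filter c. \<forall>\<nu>\<in>A_set N (KN c N) b (m N). \<bar>\<epsilon> N \<nu>\<bar> < e" if e: "0 < e" for e
  proof -
    have "((\<lambda>N. err N / real N) \<longlongrightarrow> 0) (adm_filter c)"
      unfolding err_def by (rule fluctuation_error_tendsto_0[OF m2 adm_filter_le_sequentially])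
    then have 1: "\<forall>\<^sub>F N in adm_filter c. err N / real N < e / 2"
      using e by (intro order_tendstoD(2)) auto
    have "\<forall>\<^sub>F N in adm_filter c. ln (fact (KN c N)) + real N * (L - e / 2) \<le> ln (real (W N))"
      unfolding L_def W_def
      using ln_card_Omega_bm_ge[OF b \<alpha> _ m fluctuation_error_tendsto_0[OF m2 adm_filter_le_sequentially],
          of "e / 2"] e by simp
    moreover have "\<forall>\<^sub>F N in adm_filter c. N \<in> admissible c" by (simp add: eventually_adm_filter)
    ultimately show ?thesis using 1
    proof eventually_elim
      case (elim N)
      have N: "real N > 0" using elim by (auto simp: admissible_def)
      have err: "err N < e / 2 * real N" using elim N by (simp add: pos_divide_less_eq)
      show ?case
      proof
        fix \<nu> assume \<nu>: "\<nu> \<in> A_set N (KN c N) b (m N)"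
        note * = main[OF elim(2) \<nu>]
        \<comment> \<open>The upper bound on \<open>W N\<close> bounds the error from below by
          \<open>- err N\<close>; the lower bound, with its e / 2, bounds it from above.\<close>
        have up: "ln (real (W N)) \<le> ln (fact (KN c N)) + real N * L"
          using ln_card_Omega_bm_le[OF \<alpha>(1), of N "KN c N" b "m N"] * 
          by (simp add: W_def L_def K[OF elim(2)] algebra_simps)
        have "real N * \<epsilon> N \<nu> = ln (pr N \<nu>) + H N \<nu> + real N * L"
          using N by (simp add: \<epsilon>_def algebra_simps)
        moreover have "real N * (L - e / 2) = real N * L - e / 2 * real N" by (simp add: algebra_simps)
        ultimately have "\<bar>real N * \<epsilon> N \<nu>\<bar> < e * real N"
          using * up elim(1) err by (simp add: abs_le_iff abs_less_iff)
        then show "\<bar>\<epsilon> N \<nu>\<bar> < e" using N by (simp add: abs_mult mult.commute)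
      qed
    qed
  qed
  moreover have "ereal (1 / real N * ln (pr N \<nu>)) =
      - rel_entropy b (theta N b \<nu>) (rho b \<alpha>) + ereal (\<epsilon> N \<nu>)"
    if "N \<in> admissible c" and "\<nu> \<in> A_set N (KN c N) b (m N)" for N \<nu>
    using main[OF that] by (simp add: \<epsilon>_def)
  ultimately show ?thesis
    unfolding Let_def pr_def[symmetric] using main by blast
qed

theorem theorem3p1:
  fixes b :: nat and c :: real
  assumes "real b < c"
  shows
    "((\<exists>!\<alpha>. 0 < \<alpha> \<and> rho b \<alpha> \<in> prob_mean b c) \<and>
      (b = 0 \<longrightarrow> alpha b c = c) \<and>
      (1 \<le> b \<longrightarrow>
         0 < alpha b c \<and> alpha b c * Z (b - 1) (alpha b c) / Z b (alpha b c) = c \<and>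
         (\<forall>\<alpha>>0. \<alpha> * Z (b - 1) \<alpha> / Z b \<alpha> = c \<longrightarrow> \<alpha> = alpha b c)))
     \<and>
     (c \<in> \<rat> \<longrightarrow>
      (\<forall>m :: nat \<Rightarrow> nat.
         (\<forall>N\<in>admissible c. 2 \<le> m N \<and> m N \<le> N) \<longrightarrow>
         filterlim m at_top (adm_filter c) \<longrightarrow>
         ((\<lambda>N. (real (m N))\<^sup>2 / real N) \<longlongrightarrow> 0) (adm_filter c) \<longrightarrow>
         (\<forall>N\<in>admissible c. \<forall>\<nu>\<in>A_set N (KN c N) b (m N).
            theta N b \<nu> \<in> prob_mean b c \<and>
            \<bar>rel_entropy b (theta N b \<nu>) (rho b (alpha b c))\<bar> \<noteq> \<infinity>) \<and>
         (\<exists>\<epsilon> :: nat \<Rightarrow> (nat \<Rightarrow> nat) \<Rightarrow> real.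
            (\<forall>N\<in>admissible c. \<forall>\<nu>\<in>A_set N (KN c N) b (m N).
               let P = P_unif N (KN c N) b (m N);
                   p = measure P {\<omega> \<in> space P. Theta N (KN c N) b \<omega> = theta N b \<nu>}
               in 0 < p \<and>
                  ereal (1 / real N * ln p) =
                    - rel_entropy b (theta N b \<nu>) (rho b (alpha b c)) + ereal (\<epsilon> N \<nu>)) \<and>
            (\<forall>e>0. \<forall>\<^sub>F N in adm_filter c.
               \<forall>\<nu>\<in>A_set N (KN c N) b (m N). \<bar>\<epsilon> N \<nu>\<bar> < e))))"
proof -
  obtain \<alpha> where \<alpha>: "0 < \<alpha>" "\<alpha> * Z (b - 1) \<alpha> / Z b \<alpha> = c"
    using rho_mean_exists[OF assms] by blast
  note ex1 = ex1_rho_prob_mean(1)[OF \<alpha>] and a = ex1_rho_prob_mean(2)[OF \<alpha>]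
  have uniq: "\<beta> = \<alpha>" if "0 < \<beta>" "\<beta> * Z (b - 1) \<beta> / Z b \<beta> = c" for \<beta>
    by (rule rho_mean_unique[where b = b]) (use that \<alpha> in auto)
  have zero: "alpha b c = c" if "b = 0"
  proof -
    \<comment> \<open>The truncated difference \<open>b - 1\<close> is 0 here, so the two
      normalisations coincide and cancel.\<close>
    have "\<alpha> * Z 0 \<alpha> / Z 0 \<alpha> = c" using \<alpha>(2) that by simp
    then show ?thesis unfolding a using Z_pos[OF \<alpha>(1), of 0] by simp
  qed
  have theta: "theta N b \<nu> \<in> prob_mean b c"
    and entropy: "\<bar>rel_entropy b (theta N b \<nu>) (rho b \<alpha>)\<bar> \<noteq> \<infinity>"
    if N: "N \<in> admissible c" and \<nu>: "\<nu> \<in> A_set N (KN c N) b M" for N \<nu> M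
  proof -
    have N1: "1 \<le> N" using N by (auto simp: admissible_def)
    have K: "real (KN c N) = c * real N" by (rule KN_eq[OF N]) (use assms in auto)
    show "theta N b \<nu> \<in> prob_mean b c" by (rule theta_prob_mean[OF \<nu> N1 K])
    show "\<bar>rel_entropy b (theta N b \<nu>) (rho b \<alpha>)\<bar> \<noteq> \<infinity>"
      unfolding rel_entropy_theta_rho[OF \<nu> N1 \<alpha>(1) K] by simp
  qed
  show ?thesis
    unfolding a
    by (intro conjI impI allI ballI ex1 zero[unfolded a] \<alpha> uniq theta entropy
        local_large_deviation_estimate[OF assms \<alpha>]; assumption)
qed

end
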